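(* Suppose that for every free of infinity Coxeter graph $\Gamma$ the Artin-Tits group $A_\Gamma$ is torsion free. Then for every Coxeter graph $\Gamma$ the Artin-Tits group $A_\Gamma$ is torsion free.
   Context: Let $S$ be a finite set. A Coxeter matrix over $S$ is a square matrix $M=(m_{s,t})_{s,t\in S}$ with $m_{s,s}=1$ for all $s\in S$ and $m_{s,t}=m_{t,s}\in\{2,3,4,\dots,\infty\}$ for all $s\neq t$ in $S$. It is represented by its Coxeter graph $\Gamma$: the labeled graph with vertex set $S$ in which two vertices $s,t$ are joined by an edge if $m_{s,t}\ge 3$ (including $m_{s,t}=\infty$), this edge being labeled by $m_{s,t}$ if $m_{s,t}\ge 4$. All Coxeter graphs have finite vertex set. For two letters $a,b$ and an integer $m\ge 2$, set $\Pi(a,b:m)=(ab)^{m/2}$ if $m$ is even and $\Pi(a,b:m)=(ab)^{(m-1)/2}a$ if $m$ is odd. Let $\Sigma=\{\sigma_s ; s\in S\}$ be a set in one-to-one correspondence with $S$. The Artin-Tits group of type $\Gamma$ is $$A_\Gamma=\langle \Sigma \mid \Pi(\sigma_s,\sigma_t:m_{s,t})=\Pi(\sigma_t,\sigma_s:m_{s,t}) \text{ for } s,t\in S,\ s\neq t,\ m_{s,t}\neq\infty\rangle.$$ A Coxeter graph $\Gamma$ is called free of infinity if $m_{s,t}\neq\infty$ for all $s,t\in S$, $s\neq t$. *)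

theory Defs
  imports "HOL-Algebra.Group" "HOL-Library.Extended_Nat"
begin

section \<open>Groups given by generators and relations\<close>

text \<open>The letter \<open>(a, True)\<close> stands for the generator \<open>a\<close> and \<open>(a, False)\<close> for its formal inverse.\<close>

type_synonym 'a gword = "('a \<times> bool) list"

abbreviation gwords :: "'a set \<Rightarrow> 'a gword set" where
  "gwords X \<equiv> lists (X \<times> UNIV)"

text \<open>
  The classes of this relation are the elements of the free group on \<open>X\<close> modulo the normal
  closure of the elements \<open>r r'\<^sup>-\<^sup>1\<close> with \<open>(r, r') \<in> R\<close>.
\<close>

inductive word_eq :: "'a set \<Rightarrow> ('a gword \<times> 'a gword) set \<Rightarrow> 'a gword \<Rightarrow> 'a gword \<Rightarrow> bool"
  for X :: "'a set" and R :: "('a gword \<times> 'a gword) set" where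
  refl: "w \<in> gwords X \<Longrightarrow> word_eq X R w w"
| sym: "word_eq X R v w \<Longrightarrow> word_eq X R w v"
| trans: "word_eq X R u v \<Longrightarrow> word_eq X R v w \<Longrightarrow> word_eq X R u w"
| cancel: "u \<in> gwords X \<Longrightarrow> v \<in> gwords X \<Longrightarrow> a \<in> X \<Longrightarrow>
    word_eq X R (u @ [(a, e), (a, \<not> e)] @ v) (u @ v)"
| relation: "u \<in> gwords X \<Longrightarrow> v \<in> gwords X \<Longrightarrow> r \<in> gwords X \<Longrightarrow> r' \<in> gwords X \<Longrightarrow>
    (r, r') \<in> R \<Longrightarrow> word_eq X R (u @ r @ v) (u @ r' @ v)"

definition word_rel :: "'a set \<Rightarrow> ('a gword \<times> 'a gword) set \<Rightarrow> ('a gword \<times> 'a gword) set" where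
  "word_rel X R = {(v, w). word_eq X R v w}"

definition presented_group :: "'a set \<Rightarrow> ('a gword \<times> 'a gword) set \<Rightarrow> 'a gword set monoid" where
  "presented_group X R =
     \<lparr>carrier = gwords X // word_rel X R,
      mult = (\<lambda>A B. \<Union>v\<in>A. \<Union>w\<in>B. word_rel X R `` {v @ w}),
      one = word_rel X R `` {[]}\<rparr>"

lemma word_eq_gwords:
  assumes "word_eq X R v w"
  shows "v \<in> gwords X \<and> w \<in> gwords X"
  using assms by induction auto

lemma equiv_word_rel: "equiv (gwords X) (word_rel X R)"
proof (rule equivI)
  show "word_rel X R \<subseteq> gwords X \<times> gwords X"
    using word_eq_gwords unfolding word_rel_def by blast
  show "refl_on (gwords X) (word_rel X R)"
    unfolding refl_on_def word_rel_def by (auto intro: word_eq.refl)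
  show "sym (word_rel X R)"
    by (rule symI) (simp add: word_rel_def word_eq.sym)
  show "trans (word_rel X R)"
    by (rule transI) (simp add: word_rel_def, rule word_eq.trans)
qed

lemma word_eq_context:
  assumes "word_eq X R v w" "p \<in> gwords X" "q \<in> gwords X"
  shows "word_eq X R (p @ v @ q) (p @ w @ q)"
  using assms
proof induction
  case (refl w)
  then show ?case by (intro word_eq.refl) auto
next
  case (sym v w)
  show ?case by (rule word_eq.sym) (rule sym.IH[OF sym.prems])
next
  case (trans u v w)
  show ?case by (rule word_eq.trans) (rule trans.IH[OF trans.prems])+
next
  case (cancel u v a e)
  have "word_eq X R ((p @ u) @ [(a, e), (a, \<not> e)] @ (v @ q)) ((p @ u) @ (v @ q))"
    by (rule word_eq.cancel) (use cancel in auto)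
  then show ?case by simp
next
  case (relation u v r r')
  have "word_eq X R ((p @ u) @ r @ (v @ q)) ((p @ u) @ r' @ (v @ q))"
    by (rule word_eq.relation) (use relation in auto)
  then show ?case by simp
qed

lemma word_eq_append:
  assumes "word_eq X R v v'" "word_eq X R w w'"
  shows "word_eq X R (v @ w) (v' @ w')"
proof -
  have "word_eq X R ([] @ v @ w) ([] @ v' @ w)"
    using assms word_eq_gwords[OF assms(2)] by (intro word_eq_context) auto
  moreover have "word_eq X R (v' @ w @ []) (v' @ w' @ [])"
    using assms word_eq_gwords[OF assms(1)] by (intro word_eq_context) auto
  ultimately show ?thesis
    using word_eq.trans[of X R "v @ w" "v' @ w" "v' @ w'"] by simp
qed

lemma presented_group_mult_class:
  assumes "v \<in> gwords X" "w \<in> gwords X"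
  shows "word_rel X R `` {v} \<otimes>\<^bsub>presented_group X R\<^esub> word_rel X R `` {w} = word_rel X R `` {v @ w}"
proof -
  have "word_rel X R `` {v' @ w'} = word_rel X R `` {v @ w}"
    if "v' \<in> word_rel X R `` {v}" "w' \<in> word_rel X R `` {w}" for v' w'
    using that word_eq_append[of X R v v' w w']
    by (intro equiv_class_eq[OF equiv_word_rel, symmetric]) (simp add: word_rel_def)
  moreover have "v \<in> word_rel X R `` {v}" "w \<in> word_rel X R `` {w}"
    using assms by (simp_all add: word_rel_def word_eq.refl)
  ultimately have "(\<Union>v'\<in>word_rel X R `` {v}. \<Union>w'\<in>word_rel X R `` {w}. word_rel X R `` {v' @ w'})
      = word_rel X R `` {v @ w}"
    by blast
  then show ?thesis
    by (simp add: presented_group_def)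
qed

lemma word_eq_inverse:
  assumes "w \<in> gwords X"
  shows "word_eq X R (rev (map (\<lambda>(a, e). (a, \<not> e)) w) @ w) []"
  using assms
proof (induction w)
  case Nil
  then show ?case by (simp add: word_eq.refl)
next
  case (Cons x w)
  obtain a e where x: "x = (a, e)" by force
  let ?u = "rev (map (\<lambda>(a, e). (a, \<not> e)) w)"
  have "a \<in> X" "w \<in> gwords X" "?u \<in> gwords X"
    using Cons.hyps x by (auto simp: in_lists_conv_set)
  then have "word_eq X R (?u @ [(a, \<not> e), (a, \<not> \<not> e)] @ w) (?u @ w)"
    by (intro word_eq.cancel)
  from word_eq.trans[OF this Cons.IH] show ?case
    by (simp add: x)
qed

lemma group_presented_group: "group (presented_group X R)"
proof (rule groupI)
  let ?G = "presented_group X R"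
  let ?c = "\<lambda>w. word_rel X R `` {w}"
  have classE: "\<exists>w\<in>gwords X. x = ?c w" if "x \<in> carrier ?G" for x
    using that by (auto simp: presented_group_def elim: quotientE)
  have classI: "?c w \<in> carrier ?G" if "w \<in> gwords X" for w
    using that by (simp add: presented_group_def quotientI)
  have one: "\<one>\<^bsub>?G\<^esub> = ?c []"
    by (simp add: presented_group_def)
  note mult = presented_group_mult_class[of _ X _ R]
  show "x \<otimes>\<^bsub>?G\<^esub> y \<in> carrier ?G" if xy: "x \<in> carrier ?G" "y \<in> carrier ?G" for x y
  proof -
    obtain v w where vw: "v \<in> gwords X" "w \<in> gwords X" "x = ?c v" "y = ?c w"
      using classE xy by blast
    then show ?thesis
      using classI[of "v @ w"] mult[of v w] append_in_lists_conv[of v w] by metis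
  qed
  show "\<one>\<^bsub>?G\<^esub> \<in> carrier ?G"
    unfolding one by (rule classI) simp
  show "x \<otimes>\<^bsub>?G\<^esub> y \<otimes>\<^bsub>?G\<^esub> z = x \<otimes>\<^bsub>?G\<^esub> (y \<otimes>\<^bsub>?G\<^esub> z)"
    if xyz: "x \<in> carrier ?G" "y \<in> carrier ?G" "z \<in> carrier ?G" for x y z
  proof -
    obtain u v w where uvw: "u \<in> gwords X" "v \<in> gwords X" "w \<in> gwords X"
        and eqs: "x = ?c u" "y = ?c v" "z = ?c w"
      using classE xyz by metis
    have "u @ v \<in> gwords X" "v @ w \<in> gwords X"
      using uvw by auto
    then show ?thesis
      unfolding eqs using uvw by (simp only: mult append_assoc)
  qed
  show "\<one>\<^bsub>?G\<^esub> \<otimes>\<^bsub>?G\<^esub> x = x" if "x \<in> carrier ?G" for x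
  proof -
    obtain w where "w \<in> gwords X" "x = ?c w"
      using classE \<open>x \<in> carrier ?G\<close> by blast
    then show ?thesis
      using mult[of "[]" w] one by simp
  qed
  show "\<exists>y\<in>carrier ?G. y \<otimes>\<^bsub>?G\<^esub> x = \<one>\<^bsub>?G\<^esub>" if "x \<in> carrier ?G" for x
  proof -
    obtain w where w: "w \<in> gwords X" "x = ?c w"
      using classE \<open>x \<in> carrier ?G\<close> by blast
    let ?u = "rev (map (\<lambda>(a, e). (a, \<not> e)) w)"
    have u: "?u \<in> gwords X"
      using w(1) by (auto simp: in_lists_conv_set)
    have "?c (?u @ w) = ?c []"
      using word_eq_inverse[OF w(1)]
      by (intro equiv_class_eq[OF equiv_word_rel]) (simp add: word_rel_def)
    then have "?c ?u \<otimes>\<^bsub>?G\<^esub> x = \<one>\<^bsub>?G\<^esub>"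
      unfolding w(2) one using mult[OF u w(1)] by simp
    then show ?thesis
      using classI[OF u] by blast
  qed
qed

definition torsion_free :: "('a, 'b) monoid_scheme \<Rightarrow> bool" where
  "torsion_free G \<longleftrightarrow>
     (\<forall>x\<in>carrier G. \<forall>n::nat. 0 < n \<longrightarrow> x [^]\<^bsub>G\<^esub> n = \<one>\<^bsub>G\<^esub> \<longrightarrow> x = \<one>\<^bsub>G\<^esub>)"


section \<open>Coxeter graphs and Artin-Tits groups\<close>

text \<open>
  A Coxeter graph and its Coxeter matrix determine each other, so a Coxeter graph is rendered as
  its vertex set \<open>S\<close> together with the matrix \<open>m\<close>; two distinct vertices \<open>s, t\<close> are joined
  by an edge iff \<open>3 \<le> m s t\<close>. Values of \<open>m\<close> outside \<open>S \<times> S\<close> are irrelevant.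
  As \<open>S\<close> is finite, every Coxeter graph is isomorphic to one with \<open>S :: nat set\<close>, so
  quantifying over these inside a formula covers all Coxeter graphs.
\<close>

definition coxeter_graph :: "'a set \<Rightarrow> ('a \<Rightarrow> 'a \<Rightarrow> enat) \<Rightarrow> bool" where
  "coxeter_graph S m \<longleftrightarrow>
     finite S \<and>
     (\<forall>s\<in>S. m s s = 1) \<and>
     (\<forall>s\<in>S. \<forall>t\<in>S. s \<noteq> t \<longrightarrow> m s t = m t s \<and> 2 \<le> m s t)"

definition free_of_infinity :: "'a set \<Rightarrow> ('a \<Rightarrow> 'a \<Rightarrow> enat) \<Rightarrow> bool" where
  "free_of_infinity S m \<longleftrightarrow> (\<forall>s\<in>S. \<forall>t\<in>S. s \<noteq> t \<longrightarrow> m s t \<noteq> \<infinity>)"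

definition alternating :: "'a \<Rightarrow> 'a \<Rightarrow> nat \<Rightarrow> 'a list" where
  "alternating a b k =
     (if even k then concat (replicate (k div 2) [a, b])
      else concat (replicate ((k - 1) div 2) [a, b]) @ [a])"

definition artin_relations :: "'a set \<Rightarrow> ('a \<Rightarrow> 'a \<Rightarrow> enat) \<Rightarrow> ('a gword \<times> 'a gword) set" where
  "artin_relations S m =
     {(alternating (s, True) (t, True) k, alternating (t, True) (s, True) k) | s t k.
        s \<in> S \<and> t \<in> S \<and> s \<noteq> t \<and> m s t = enat k}"

definition artin_group :: "'a set \<Rightarrow> ('a \<Rightarrow> 'a \<Rightarrow> enat) \<Rightarrow> 'a gword set monoid" where
  "artin_group S m = presented_group S (artin_relations S m)"

end

theory Submission
  imports Defs Complex_Main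
begin

text \<open>
  If \<open>m s t = \<infinity>\<close>, then no relation involves both \<open>s\<close> and \<open>t\<close>, so \<open>A\<^bsub>S\<^esub>\<close> is the
  pushout of \<open>A\<^bsub>S - {s}\<^esub>\<close> and \<open>A\<^bsub>S - {t}\<^esub>\<close> along \<open>A\<^bsub>S - {s, t}\<^esub>\<close>. If the two maps from
  \<open>A\<^bsub>S - {s, t}\<^esub>\<close> are injective, this pushout is an amalgamated product, and an element of finite
  order in an amalgamated product is conjugate into a factor; so torsion freeness follows by
  induction on the number of vertices, starting from the graphs that are free of infinity.

  Injectivity is van der Lek's theorem that the standard parabolic subgroup generated by
  \<open>X \<subseteq> S\<close> is \<open>A\<^bsub>X\<^esub>\<close> (\<open>artin_parabolic_embedding\<close>). It is proved by extending an action
  of \<open>A\<^bsub>X\<^esub>\<close> on a set to an action of \<open>A\<^bsub>S\<^esub>\<close> on the product of this set with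
  the coset space of the parabolic subgroup \<open>W\<^bsub>X\<^esub>\<close> in the Coxeter group \<open>W\<close>. A coset is
  represented by the \<open>u \<in> W\<close> that keeps all simple roots of \<open>X\<close> positive. The generator \<open>a\<close> sends
  such a \<open>u\<close> to \<open>a u\<close>, unless \<open>u\<close> sends the simple root of some \<open>x \<in> X\<close> to that of \<open>a\<close>; then
  the coset is fixed and \<open>x\<close> acts on the first component instead. At the coset of the
  identity the group \<open>A\<^bsub>X\<^esub>\<close> acts as given, so the regular action of \<open>A\<^bsub>X\<^esub>\<close> shows that no
  element of \<open>A\<^bsub>X\<^esub>\<close> is lost in \<open>A\<^bsub>S\<^esub>\<close>. That the braid relations hold (\<open>braid_step\<close>) is
  a statement about walks of length \<open>m s t\<close> in the plane of two simple roots. It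
  rests on the fact that every root is positive or negative (\<open>root_nonneg_or_nonpos\<close>), which is
  proved for the group generated by the reflections of the geometric representation.

  For the amalgamated product (\<open>torsion_free_amalgam\<close>) the two factors act on a set of normal forms
  so that a product of elements taken alternately from the two factors, none of them from the
  common subgroup, moves the base point. A torsion element, conjugated so as to have as few syllables
  as possible and still having at least two, would have powers of this kind.
\<close>

section \<open>Words, classes and actions\<close>

lemma class_eq_iff:
  assumes "v \<in> gwords X" "w \<in> gwords X"
  shows "word_rel X R `` {v} = word_rel X R `` {w} \<longleftrightarrow> word_eq X R v w"
  using eq_equiv_class_iff[OF equiv_word_rel assms] by (simp add: word_rel_def)

lemma class_in_carrier: "w \<in> gwords X \<Longrightarrow> word_rel X R `` {w} \<in> carrier (presented_group X R)"
  by (simp add: presented_group_def quotientI)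

lemma carrier_classE:
  assumes "x \<in> carrier (presented_group X R)"
  obtains w where "w \<in> gwords X" "x = word_rel X R `` {w}"
  using assms unfolding presented_group_def by (auto elim!: quotientE simp del: in_lists_conv_set)

lemma one_class: "\<one>\<^bsub>presented_group X R\<^esub> = word_rel X R `` {[]}"
  by (simp add: presented_group_def)

lemma power_gwords: "w \<in> gwords X \<Longrightarrow> concat (replicate n w) \<in> gwords X"
  by (induction n) auto

lemma pow_class:
  assumes "w \<in> gwords X"
  shows "(word_rel X R `` {w}) [^]\<^bsub>presented_group X R\<^esub> n
           = word_rel X R `` {concat (replicate n w)}"
proof (induction n)
  case 0
  show ?case by (simp add: one_class)
next
  case (Suc n)
  have "concat (replicate n w) @ w = concat (replicate (Suc n) w)"
    by (induction n) auto
  with Suc assms show ?case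
    by (simp add: power_gwords presented_group_mult_class del: replicate.simps)
qed

text \<open>
  All later arguments about torsion take place on the level of words, through this criterion.
\<close>

lemma torsion_free_presented_group_iff:
  "torsion_free (presented_group X R) \<longleftrightarrow>
     (\<forall>w\<in>gwords X. \<forall>n>0. word_eq X R (concat (replicate n w)) [] \<longrightarrow> word_eq X R w [])"
proof -
  have "(\<forall>x\<in>carrier (presented_group X R). Q x) \<longleftrightarrow> (\<forall>w\<in>gwords X. Q (word_rel X R `` {w}))" for Q
    using carrier_classE class_in_carrier by metis
  then show ?thesis
    by (simp add: torsion_free_def pow_class one_class class_eq_iff power_gwords)
qed

lemma word_eq_map:
  assumes "word_eq X R v w"
    and "f ` X \<subseteq> Y"
    and "\<And>r r'. (r, r') \<in> R \<Longrightarrow> r \<in> gwords X \<Longrightarrow> r' \<in> gwords X \<Longrightarrow>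
           (map (apfst f) r, map (apfst f) r') \<in> R'"
  shows "word_eq Y R' (map (apfst f) v) (map (apfst f) w)"
proof -
  have img: "map (apfst f) u \<in> gwords Y" if "u \<in> gwords X" for u
    using that assms(2) by (induction u) auto
  show ?thesis
    using assms(1)
  proof induction
    case (refl w)
    then show ?case by (intro word_eq.refl img)
  next
    case (sym v w)
    show ?case by (rule word_eq.sym[OF sym.IH])
  next
    case (trans u v w)
    then show ?case by (blast intro: word_eq.trans)
  next
    case (cancel u v a e)
    have "f a \<in> Y" using cancel assms(2) by blast
    from word_eq.cancel[OF img[OF cancel(1)] img[OF cancel(2)] this] show ?case by simp
  next
    case (relation u v r r')
    from word_eq.relation[OF img[OF relation(1)] img[OF relation(2)] img[OF relation(3)]
        img[OF relation(4)] assms(3)[OF relation(5,3,4)]]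
    show ?case by simp
  qed
qed

lemma word_eq_mono:
  assumes "word_eq X R v w" "X \<subseteq> Y" "R \<subseteq> R'"
  shows "word_eq Y R' v w"
proof -
  have "apfst id = (id :: 'a \<times> bool \<Rightarrow> _)" by auto
  then show ?thesis
    using word_eq_map[OF assms(1), of id Y R'] assms(2,3) by auto
qed

definition inverse_word :: "'a gword \<Rightarrow> 'a gword" where
  "inverse_word w = rev (map (\<lambda>(a, e). (a, \<not> e)) w)"

lemma inverse_word_gwords: "w \<in> gwords X \<Longrightarrow> inverse_word w \<in> gwords X"
  by (auto simp: inverse_word_def in_lists_conv_set)

lemma inverse_word_inverse_word [simp]: "inverse_word (inverse_word w) = w"
  by (induction w) (auto simp: inverse_word_def)

lemma word_eq_inverse_left: "w \<in> gwords X \<Longrightarrow> word_eq X R (inverse_word w @ w) []"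
  by (simp add: inverse_word_def word_eq_inverse)

lemma word_eq_inverse_right: "w \<in> gwords X \<Longrightarrow> word_eq X R (w @ inverse_word w) []"
  using word_eq_inverse_left[OF inverse_word_gwords] by simp

text \<open>
  A word acts with its last letter first. Each letter acts by a permutation of the whole type, and a
  formal inverse by the inverse permutation.
\<close>

definition act :: "('a \<Rightarrow> 'c \<Rightarrow> 'c) \<Rightarrow> 'a gword \<Rightarrow> 'c \<Rightarrow> 'c" where
  "act f w = foldr (\<lambda>(a, e). if e then f a else inv_into UNIV (f a)) w"

lemma act_Nil [simp]: "act f [] c = c"
  by (simp add: act_def)

lemma act_Cons: "act f ((a, e) # w) c = (if e then f a else inv_into UNIV (f a)) (act f w c)"
  by (simp add: act_def)

lemma act_append: "act f (v @ w) c = act f v (act f w c)"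
  by (simp add: act_def)

lemma act_positive: "act f (map (\<lambda>a. (a, True)) w) = foldr f w"
  by (rule ext, induction w) (auto simp: act_Cons)

text \<open>
  The universal property of a presentation: a family of permutations that satisfies the relations is
  an action of the presented group.
\<close>

lemma word_eq_act:
  assumes "word_eq X R v w"
    and bij: "\<And>a. a \<in> X \<Longrightarrow> bij (f a)"
    and rel: "\<And>r r'. (r, r') \<in> R \<Longrightarrow> act f r = act f r'"
  shows "act f v = act f w"
  using assms(1)
proof induction
  case (cancel u v a e)
  have "f a (inv_into UNIV (f a) c) = c" "inv_into UNIV (f a) (f a c) = c" for c
    using bij[OF cancel(3)] by (simp_all add: bij_is_surj surj_f_inv_f bij_is_inj inv_f_f)
  then have "act f [(a, e), (a, \<not> e)] c = c" for c
    by (simp add: act_Cons)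
  then show ?case
    by (intro ext) (simp only: act_append)
next
  case (relation u v r r')
  then show ?case
    using rel by (intro ext) (simp add: act_append)
qed simp_all

text \<open>
  The regular representation. Left multiplication only makes sense on the carrier; the identity
  elsewhere makes it a permutation of the whole type.
\<close>

definition regular :: "'a set \<Rightarrow> ('a gword \<times> 'a gword) set \<Rightarrow> 'a \<Rightarrow> 'a gword set \<Rightarrow> 'a gword set" where
  "regular X R a c = (if c \<in> carrier (presented_group X R)
     then word_rel X R `` {[(a, True)]} \<otimes>\<^bsub>presented_group X R\<^esub> c else c)"

lemma bij_left_mult_extended:
  assumes "group G" "g \<in> carrier G"
  shows "bij (\<lambda>c. if c \<in> carrier G then g \<otimes>\<^bsub>G\<^esub> c else c)"
    and "inv_into UNIV (\<lambda>c. if c \<in> carrier G then g \<otimes>\<^bsub>G\<^esub> c else c)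
           = (\<lambda>c. if c \<in> carrier G then inv\<^bsub>G\<^esub> g \<otimes>\<^bsub>G\<^esub> c else c)"
proof -
  interpret group G by fact
  let ?f = "\<lambda>c. if c \<in> carrier G then g \<otimes>\<^bsub>G\<^esub> c else c"
  let ?h = "\<lambda>c. if c \<in> carrier G then inv\<^bsub>G\<^esub> g \<otimes>\<^bsub>G\<^esub> c else c"
  have "?h (?f c) = c" "?f (?h c) = c" for c
    using assms(2) by (simp_all add: m_assoc[symmetric])
  then have fh: "?h \<circ> ?f = id" "?f \<circ> ?h = id" by auto
  then show "bij ?f" by (rule o_bij)
  show "inv_into UNIV ?f = ?h"
    using fh by (intro inv_unique_comp)
qed

lemma inv_class:
  assumes "w \<in> gwords X"
  shows "inv\<^bsub>presented_group X R\<^esub> (word_rel X R `` {w}) = word_rel X R `` {inverse_word w}"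
proof -
  interpret group "presented_group X R" by (rule group_presented_group)
  show ?thesis
  proof (rule inv_equality)
    show "word_rel X R `` {inverse_word w} \<otimes>\<^bsub>presented_group X R\<^esub> word_rel X R `` {w}
        = \<one>\<^bsub>presented_group X R\<^esub>"
      using assms word_eq_inverse_left[OF assms]
      by (simp add: presented_group_mult_class inverse_word_gwords one_class class_eq_iff)
  qed (rule class_in_carrier, rule assms inverse_word_gwords[OF assms])+
qed

lemma bij_regular: "a \<in> X \<Longrightarrow> bij (regular X R a)"
  unfolding regular_def[abs_def]
  by (rule bij_left_mult_extended[OF group_presented_group]) (auto intro: class_in_carrier)

lemma act_regular:
  assumes "w \<in> gwords X" "c \<in> carrier (presented_group X R)"
  shows "act (regular X R) w c = word_rel X R `` {w} \<otimes>\<^bsub>presented_group X R\<^esub> c"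
  using assms(1)
proof (induction w)
  interpret group "presented_group X R" by (rule group_presented_group)
  {
    case Nil
    show ?case using assms(2) by (simp flip: one_class)
  next
    case (Cons x w)
    obtain a e where x: "x = (a, e)" by force
    have a: "[(a, e)] \<in> gwords X" "a \<in> X" "w \<in> gwords X" using Cons.hyps x by auto
    let ?c = "\<lambda>w. word_rel X R `` {w}"
    have inv: "inv_into UNIV (regular X R a) = (\<lambda>c. if c \<in> carrier (presented_group X R)
        then inv\<^bsub>presented_group X R\<^esub> (?c [(a, True)]) \<otimes>\<^bsub>presented_group X R\<^esub> c else c)"
      unfolding regular_def[abs_def] using a(2)
      by (intro bij_left_mult_extended group_presented_group class_in_carrier) auto
    have cl: "?c w \<in> carrier (presented_group X R)" "?c [(a, e)] \<in> carrier (presented_group X R)"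
      using a by (auto intro: class_in_carrier)
    have "inv\<^bsub>presented_group X R\<^esub> (?c [(a, True)]) = ?c [(a, False)]"
      using a by (subst inv_class) (auto simp: inverse_word_def)
    moreover have "?c w \<otimes>\<^bsub>presented_group X R\<^esub> c \<in> carrier (presented_group X R)"
      using cl(1) assms(2) by simp
    ultimately have "act (regular X R) (x # w) c = ?c [(a, e)] \<otimes>\<^bsub>presented_group X R\<^esub> (?c w \<otimes>\<^bsub>presented_group X R\<^esub> c)"
      by (cases e) (simp_all add: x act_Cons inv Cons.IH, simp_all add: regular_def)
    also have "\<dots> = ?c ([(a, e)] @ w) \<otimes>\<^bsub>presented_group X R\<^esub> c"
      using cl assms(2) a by (simp only: m_assoc[symmetric] presented_group_mult_class)
    finally show ?case by (simp add: x)
  }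
qed

lemma act_regular_outside:
  assumes "w \<in> gwords X" "c \<notin> carrier (presented_group X R)"
  shows "act (regular X R) w c = c"
  using assms(1)
proof (induction w)
  case (Cons x w)
  obtain a e where x: "x = (a, e)" by force
  have "a \<in> X" using Cons.hyps x by auto
  then have "regular X R a c = c" "inv_into UNIV (regular X R a) c = c"
    using assms(2) bij_inv_eq_iff[OF bij_regular, of a X c R c] by (auto simp: regular_def)
  then show ?case using Cons.IH by (simp add: x act_Cons)
qed simp

lemma act_regular_cong:
  assumes "word_eq X R v w"
  shows "act (regular X R) v = act (regular X R) w"
proof
  fix c
  have vw: "v \<in> gwords X" "w \<in> gwords X" using word_eq_gwords[OF assms] by auto
  then have "word_rel X R `` {v} = word_rel X R `` {w}" using assms by (simp add: class_eq_iff)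
  then show "act (regular X R) v c = act (regular X R) w c"
    using act_regular[OF vw(1)] act_regular[OF vw(2)] act_regular_outside[OF vw(1)]
      act_regular_outside[OF vw(2)] by (cases "c \<in> carrier (presented_group X R)") auto
qed

text \<open>
  The orbit map at the identity is injective, so the regular action distinguishes all
  elements of the presented group.
\<close>

lemma act_regular_one:
  assumes "w \<in> gwords X"
  shows "act (regular X R) w (word_rel X R `` {[]}) = word_rel X R `` {w}"
  using assms act_regular[of w X "word_rel X R `` {[]}" R]
  by (simp add: class_in_carrier presented_group_mult_class)

subsection \<open>Alternating words\<close>

lemma alternating_0 [simp]: "alternating a b 0 = []"
  by (simp add: alternating_def)

lemma alternating_Suc: "alternating a b (Suc k) = a # alternating b a k"
proof -
  have "concat (replicate n [a, b]) @ [a] = a # concat (replicate n [b, a])" for n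
    by (induction n) auto
  moreover have "odd k \<Longrightarrow> Suc k div 2 = Suc ((k - 1) div 2)" 
    by (elim oddE) auto
  moreover have "concat (replicate (Suc n) [a, b]) = a # concat (replicate n [b, a]) @ [b]" for n
    by (induction n) auto
  ultimately show ?thesis
    by (auto simp: alternating_def simp del: replicate.simps concat.simps)
qed

lemma length_alternating [simp]: "length (alternating a b k) = k"
  by (induction k arbitrary: a b) (auto simp: alternating_Suc)

lemma nth_alternating: "i < k \<Longrightarrow> alternating a b k ! i = (if even i then a else b)"
  by (induction k arbitrary: a b i) (auto simp: alternating_Suc nth_Cons split: nat.splits)

lemma map_alternating: "map f (alternating a b k) = alternating (f a) (f b) k"
  by (induction k arbitrary: a b) (auto simp: alternating_Suc)

lemma set_alternating: "set (alternating a b k) \<subseteq> {a, b}"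
  by (induction k arbitrary: a b) (auto simp: alternating_Suc)

lemma alternating_snoc:
  "alternating a b (Suc k) = alternating a b k @ [if even k then a else b]"
  by (induction k arbitrary: a b) (auto simp: alternating_Suc)

lemma alternating_split:
  assumes "alternating a b k = p @ c # q"
  shows "p = alternating a b (length p)" "c = (if even (length p) then a else b)"
proof -
  have k: "length p < k" using arg_cong[OF assms, of length] by simp
  show "p = alternating a b (length p)"
  proof (rule nth_equalityI)
    fix i assume "i < length p"
    then show "p ! i = alternating a b (length p) ! i"
      using k arg_cong[OF assms, of "\<lambda>l. l ! i"] by (simp add: nth_alternating nth_append)
  qed simp
  show "c = (if even (length p) then a else b)"
    using k arg_cong[OF assms, of "\<lambda>l. l ! length p"] by (simp add: nth_alternating)
qed

lemma alternating_add:
  "alternating a b (i + j) = alternating a b i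
     @ alternating (if even i then a else b) (if even i then b else a) j"
  by (induction i arbitrary: a b) (auto simp: alternating_Suc)

lemma not_distinct_adj_split: "\<not> distinct_adj w \<Longrightarrow> \<exists>p a q. w = p @ a # a # q"
proof (induction w rule: induct_list012)
  case (3 x y zs)
  show ?case
  proof (cases "x = y")
    case True
    then have "x # y # zs = [] @ x # x # zs" by simp
    then show ?thesis by blast
  next
    case False
    then have "\<not> distinct_adj (y # zs)" using 3 by simp
    then obtain p a q where "y # zs = p @ a # a # q" using 3 by blast
    then have "x # y # zs = (x # p) @ a # a # q" by simp
    then show ?thesis by blast
  qed
qed auto

text \<open>
  A word without repetitions in two letters is one of the two alternating words of its length.
\<close>

lemma distinct_adj_alternating:
  assumes "distinct_adj w" "w \<in> lists {a, b}"
  shows "\<exists>k. w = alternating a b k \<or> w = alternating b a k"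
  using assms
proof (induction w rule: induct_list012)
  case 1
  have "[] = alternating a b 0" by simp
  then show ?case by blast
next
  case (2 x)
  have "[y] = alternating y z 1" for y z :: 'a by (simp add: alternating_Suc)
  with 2 show ?case by auto
next
  case (3 x y zs)
  then obtain k where k: "y # zs = alternating a b k \<or> y # zs = alternating b a k"
    by auto
  then obtain j where j: "k = Suc j" by (cases k) auto
  have "x # y # zs = alternating a b (Suc k) \<or> x # y # zs = alternating b a (Suc k)"
    using k 3 unfolding j by (auto simp: alternating_Suc)
  then show ?case by blast
qed

section \<open>The geometric representation of a Coxeter graph\<close>

type_synonym 'a vec = "'a \<Rightarrow> real"

definition comb :: "real \<Rightarrow> 'a vec \<Rightarrow> real \<Rightarrow> 'a vec \<Rightarrow> 'a vec" where
  "comb p v q w = (\<lambda>r. p * v r + q * w r)"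

definition simple_root :: "'a \<Rightarrow> 'a vec" where
  "simple_root s = (\<lambda>r. if r = s then 1 else 0)"

definition nonneg :: "'a vec \<Rightarrow> bool" where
  "nonneg v \<longleftrightarrow> (\<forall>r. 0 \<le> v r)"

definition nonpos :: "'a vec \<Rightarrow> bool" where
  "nonpos v \<longleftrightarrow> (\<forall>r. v r \<le> 0)"

text \<open>
  The Chebyshev polynomials of the second kind, shifted by one, at \<open>q / 2\<close>. They are the coordinates of
  the roots of a dihedral group with respect to its two simple roots.
\<close>

fun cheb :: "real \<Rightarrow> nat \<Rightarrow> real" where
  "cheb q 0 = 0"
| "cheb q (Suc 0) = 1"
| "cheb q (Suc (Suc k)) = q * cheb q (Suc k) - cheb q k"

lemma cheb_sin: "cheb (2 * cos \<theta>) k * sin \<theta> = sin (real k * \<theta>)"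
proof (induction "2 * cos \<theta>" k rule: cheb.induct)
  case (3 k)
  have "sin (real (Suc (Suc k)) * \<theta>) = 2 * cos \<theta> * sin (real (Suc k) * \<theta>) - sin (real k * \<theta>)"
  proof -
    have "real (Suc (Suc k)) * \<theta> = real (Suc k) * \<theta> + \<theta>" "real k * \<theta> = real (Suc k) * \<theta> - \<theta>"
      by (simp_all add: algebra_simps)
    then show ?thesis by (simp add: sin_add sin_diff)
  qed
  with 3 show ?case by (simp add: algebra_simps)
qed simp_all

lemma cheb_two: "cheb 2 k = real k"
  by (induction "2 :: real" k rule: cheb.induct) auto

lemma simple_root_inj: "simple_root s = simple_root t \<longleftrightarrow> s = t"
  by (auto simp: simple_root_def fun_eq_iff split: if_splits)

locale coxeter =
  fixes S :: "'a set" and m :: "'a \<Rightarrow> 'a \<Rightarrow> enat"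
  assumes coxeter_graph: "coxeter_graph S m"
begin

lemma finite_S: "finite S"
  and m_diag: "s \<in> S \<Longrightarrow> m s s = 1"
  and m_sym: "s \<in> S \<Longrightarrow> t \<in> S \<Longrightarrow> m s t = m t s"
  and m_ge2: "s \<in> S \<Longrightarrow> t \<in> S \<Longrightarrow> s \<noteq> t \<Longrightarrow> 2 \<le> m s t"
  using coxeter_graph unfolding coxeter_graph_def by metis+

text \<open>
  The label \<open>\<infinity>\<close> is treated as the limit of the finite labels, and \<open>m s s = 1\<close> gives every simple root
  norm one.
\<close>

definition gram :: "'a \<Rightarrow> 'a \<Rightarrow> real" where
  "gram s t = (case m s t of enat k \<Rightarrow> - cos (pi / real k) | \<infinity> \<Rightarrow> -1)"

definition pairing :: "'a \<Rightarrow> 'a vec \<Rightarrow> real" where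
  "pairing s v = (\<Sum>r\<in>S. v r * gram r s)"

definition form :: "'a vec \<Rightarrow> 'a vec \<Rightarrow> real" where
  "form v w = (\<Sum>s\<in>S. w s * pairing s v)"

definition reflect :: "'a \<Rightarrow> 'a vec \<Rightarrow> 'a vec" where
  "reflect s v = comb 1 v (- 2 * pairing s v) (simple_root s)"

abbreviation rho :: "'a list \<Rightarrow> 'a vec \<Rightarrow> 'a vec" where
  "rho \<equiv> foldr reflect"

lemma gram_diag: "s \<in> S \<Longrightarrow> gram s s = 1"
  by (simp add: gram_def m_diag one_enat_def)

lemma gram_sym: "s \<in> S \<Longrightarrow> t \<in> S \<Longrightarrow> gram s t = gram t s"
  by (simp add: gram_def m_sym[of s t])

lemma finite_order_ge2: "s \<in> S \<Longrightarrow> t \<in> S \<Longrightarrow> s \<noteq> t \<Longrightarrow> m s t = enat k \<Longrightarrow> 2 \<le> k"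
  using m_ge2[of s t] by (simp add: numeral_eq_enat)

text \<open>
  The cosine is injective on \<open>[0, \<pi>]\<close>, so an isometry that maps one pair of simple roots to another
  can only do so if the two pairs carry the same label.
\<close>

lemma gram_determines_order:
  assumes "s \<in> S" "t \<in> S" "s \<noteq> t" "x \<in> S" "y \<in> S" "x \<noteq> y"
    and "m s t = enat k" "gram x y = gram s t"
  shows "m x y = enat k"
proof -
  have k: "2 \<le> k" using assms finite_order_ge2 by blast
  show ?thesis
  proof (cases "m x y")
    case (enat j)
    have j: "2 \<le> j" using assms enat finite_order_ge2 by blast
    have "cos (pi / real j) = cos (pi / real k)"
      using assms enat by (simp add: gram_def)
    moreover have "0 \<le> pi / real j" "pi / real j \<le> pi" "0 \<le> pi / real k" "pi / real k \<le> pi"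
      using j k by (simp_all add: field_simps)
    ultimately have "pi / real j = pi / real k" using cos_inj_pi by blast
    then have "j = k" using j k by (simp add: field_simps)
    with enat show ?thesis by simp
  next
    case infinity
    then have "cos (pi / real k) = cos 0" using assms by (simp add: gram_def)
    moreover have "0 \<le> pi / real k" "pi / real k \<le> pi"
      using k by (simp_all add: field_simps)
    ultimately have "pi / real k = 0" using cos_inj_pi[of "pi / real k" 0] by simp
    with k show ?thesis by simp
  qed
qed

lemma pairing_comb: "pairing s (comb p v q w) = p * pairing s v + q * pairing s w"
  by (simp add: pairing_def comb_def sum_distrib_left sum.distrib algebra_simps)

lemma pairing_simple_root:
  assumes "t \<in> S"
  shows "pairing s (simple_root t) = gram t s"
proof -
  have "pairing s (simple_root t) = (\<Sum>r\<in>S. if r = t then gram r s else 0)"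
    unfolding pairing_def by (rule sum.cong) (auto simp: simple_root_def)
  with assms show ?thesis by (simp add: finite_S)
qed

lemma form_simple_root: "s \<in> S \<Longrightarrow> form v (simple_root s) = pairing s v"
proof -
  assume s: "s \<in> S"
  have "form v (simple_root s) = (\<Sum>r\<in>S. if r = s then pairing r v else 0)"
    unfolding form_def by (rule sum.cong) (auto simp: simple_root_def)
  with s show ?thesis by (simp add: finite_S)
qed

lemma form_comb_right: "form u (comb p v q w) = p * form u v + q * form u w"
  by (simp add: form_def comb_def sum_distrib_left sum.distrib algebra_simps)

lemma form_sym: "form v w = form w v"
proof -
  have "form v w = (\<Sum>s\<in>S. \<Sum>r\<in>S. w s * v r * gram r s)"
    by (simp add: form_def pairing_def sum_distrib_left algebra_simps)
  also have "\<dots> = (\<Sum>r\<in>S. \<Sum>s\<in>S. w s * v r * gram r s)"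
    by (rule sum.swap)
  also have "\<dots> = (\<Sum>r\<in>S. \<Sum>s\<in>S. v r * w s * gram s r)"
    by (intro sum.cong HOL.refl) (simp_all add: gram_sym)
  also have "\<dots> = form w v"
    by (simp add: form_def pairing_def sum_distrib_left algebra_simps)
  finally show ?thesis .
qed

lemma form_comb_left: "form (comb p v q w) u = p * form v u + q * form w u"
  using form_comb_right form_sym by metis

lemma reflect_comb: "reflect s (comb p v q w) = comb p (reflect s v) q (reflect s w)"
  by (simp add: reflect_def pairing_comb) (simp add: comb_def algebra_simps)

lemma rho_comb: "rho ws (comb p v q w) = comb p (rho ws v) q (rho ws w)"
  by (induction ws) (simp_all add: reflect_comb)

lemma pairing_reflect: "s \<in> S \<Longrightarrow> pairing s (reflect s v) = - pairing s v"
  by (simp add: reflect_def pairing_comb pairing_simple_root gram_diag)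

lemma reflect_reflect [simp]: "s \<in> S \<Longrightarrow> reflect s (reflect s v) = v"
  using pairing_reflect[of s v] by (simp add: reflect_def[of s "reflect s v"]) (simp add: reflect_def comb_def)

lemma form_reflect: "s \<in> S \<Longrightarrow> form (reflect s v) (reflect s w) = form v w"
  using form_sym[of "simple_root s" w] form_sym[of "simple_root s" "simple_root s"]
  by (simp add: reflect_def form_comb_left form_comb_right form_simple_root pairing_simple_root
      gram_diag algebra_simps)

lemma form_rho: "ws \<in> lists S \<Longrightarrow> form (rho ws v) (rho ws w) = form v w"
  by (induction ws) (simp_all add: form_reflect)

lemma reflect_simple_root: "s \<in> S \<Longrightarrow> reflect s (simple_root s) = comb (-1) (simple_root s) 0 (simple_root s)"
  by (simp add: reflect_def pairing_simple_root gram_diag) (simp add: comb_def)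

lemma rho_append: "rho (v @ w) = rho v \<circ> rho w"
  by (induction v) (auto simp: fun_eq_iff)

lemma rho_rev: "ws \<in> lists S \<Longrightarrow> rho (rev ws) (rho ws v) = v"
  by (induction ws arbitrary: v) (auto simp: rho_append)

subsection \<open>Dihedral subgroups\<close>

text \<open>
  The simple root is that of the letter by which the alternating word would continue, so that
  \<open>rho\<close> makes it travel through the positive roots of the dihedral group. Each new letter is one step of the
  Chebyshev recursion.
\<close>

lemma rho_alternating:
  assumes "s \<in> S" "t \<in> S" "s \<noteq> t"
  shows "rho (alternating s t k) (simple_root (if even k then s else t))
       = comb (cheb (- 2 * gram s t) (Suc k)) (simple_root s) (cheb (- 2 * gram s t) k) (simple_root t)"
  using assms
proof (induction k arbitrary: s t)
  case 0
  then show ?case by (simp add: comb_def)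
next
  case (Suc k)
  have swap: "(if even (Suc k) then s else t) = (if even k then t else s)" "gram s t = gram t s"
    using gram_sym[of s t] Suc.prems by simp_all
  have "rho (alternating s t (Suc k)) (simple_root (if even (Suc k) then s else t))
      = reflect s (comb (cheb (- 2 * gram s t) (Suc k)) (simple_root t) (cheb (- 2 * gram s t) k) (simple_root s))"
    using Suc.IH[OF Suc.prems(2,1) Suc.prems(3)[symmetric]] unfolding swap
    by (simp only: alternating_Suc foldr_Cons comp_apply)
  also have "\<dots> = comb (cheb (- 2 * gram s t) (Suc (Suc k))) (simple_root s)
      (cheb (- 2 * gram s t) (Suc k)) (simple_root t)"
    using Suc.prems gram_sym[of s t]
    by (simp add: reflect_def pairing_comb pairing_simple_root gram_diag)
       (simp add: comb_def algebra_simps)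
  finally show ?case .
qed

lemma cheb_finite:
  assumes "s \<in> S" "t \<in> S" "s \<noteq> t" "m s t = enat k"
  shows "cheb (- 2 * gram s t) j * sin (pi / real k) = sin (real j * pi / real k)"
    and "0 < sin (pi / real k)"
proof -
  have "2 \<le> k" using assms finite_order_ge2 by blast
  then show "0 < sin (pi / real k)" by (intro sin_gt_zero) (simp_all add: field_simps)
  show "cheb (- 2 * gram s t) j * sin (pi / real k) = sin (real j * pi / real k)"
    using assms(4) cheb_sin[of "pi / real k" j] by (simp add: gram_def)
qed

text \<open>
  With \<open>m s t = k\<close> the coordinate is \<open>sin (j \<pi> / k) / sin (\<pi> / k)\<close>, and \<open>j\<close> when \<open>m s t = \<infinity>\<close>.
\<close>

lemma cheb_pos:
  assumes "s \<in> S" "t \<in> S" "s \<noteq> t" "0 < j" "enat j < m s t"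
  shows "0 < cheb (- 2 * gram s t) j"
proof (cases "m s t")
  case (enat k)
  then have "0 < sin (real j * pi / real k)"
    using assms by (intro sin_gt_zero) (simp_all add: field_simps)
  then show ?thesis
    using cheb_finite[OF assms(1-3) enat] by (metis zero_less_mult_pos2)
next
  case infinity
  then show ?thesis using assms cheb_two[of j] by (simp add: gram_def)
qed

lemma cheb_order:
  assumes "s \<in> S" "t \<in> S" "s \<noteq> t" "m s t = enat k"
  shows "cheb (- 2 * gram s t) k = 0" "cheb (- 2 * gram s t) (Suc k) = -1"
    "cheb (- 2 * gram s t) (k - 1) = 1"
proof -
  have k: "2 \<le> k" using assms finite_order_ge2 by blast
  let ?s = "sin (pi / real k)" and ?c = "cheb (- 2 * gram s t)"
  note c = cheb_finite[OF assms]
  have "real k * pi / real k = pi" "real (Suc k) * pi / real k = pi / real k + pi"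
    "real (k - 1) * pi / real k = pi - pi / real k"
    using k by (simp_all add: field_simps of_nat_diff)
  then have "?c k * ?s = 0 * ?s" "?c (Suc k) * ?s = -1 * ?s" "?c (k - 1) * ?s = 1 * ?s"
    using c(1)[of k] c(1)[of "Suc k"] c(1)[of "k - 1"]
    by (simp_all add: sin_diff del: cheb.simps of_nat_Suc)
  then show "?c k = 0" "?c (Suc k) = -1" "?c (k - 1) = 1"
    using c(2) by (metis mult_right_cancel order_less_irrefl)+
qed

text \<open>
  Both alternating words of length \<open>m s t\<close> are minus a permutation of the two simple roots. The second
  one is computed by splitting off its last letter, which negates the simple root it is applied to.
\<close>

lemma longest_alternating:
  assumes "s \<in> S" "t \<in> S" "s \<noteq> t" "m s t = enat k"
  shows "rho (alternating s t k) (simple_root (if even k then s else t)) = comb (-1) (simple_root s) 0 (simple_root t)"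
    and "rho (alternating t s k) (simple_root (if even k then s else t)) = comb (-1) (simple_root s) 0 (simple_root t)"
proof -
  obtain j where k: "k = Suc j" using finite_order_ge2[OF assms] by (cases k) auto
  show "rho (alternating s t k) (simple_root (if even k then s else t)) = comb (-1) (simple_root s) 0 (simple_root t)"
    using rho_alternating[OF assms(1-3), of k] cheb_order[OF assms] by simp
  let ?x = "if even j then t else s"
  have ts: "m t s = enat (Suc j)" using assms m_sym k by metis
  have "rho (alternating t s k) (simple_root ?x) = rho (alternating t s j) (reflect ?x (simple_root ?x))"
    by (simp only: k alternating_snoc foldr_append foldr_Cons foldr_Nil comp_apply id_apply)
  also have "\<dots> = comb (-1) (rho (alternating t s j) (simple_root ?x)) 0
      (rho (alternating t s j) (simple_root ?x))"
    using assms by (subst reflect_simple_root) (auto simp: rho_comb)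
  also have "\<dots> = comb (-1) (simple_root s) 0 (simple_root t)"
    unfolding rho_alternating[OF assms(2,1) assms(3)[symmetric]]
    using cheb_order[OF assms(2,1) assms(3)[symmetric] ts]
    by (simp add: comb_def fun_eq_iff)
  finally show "rho (alternating t s k) (simple_root (if even k then s else t))
      = comb (-1) (simple_root s) 0 (simple_root t)"
    by (cases "even j") (simp_all add: k)
qed

text \<open>
  For a finite label the form is nondegenerate on the plane of the two simple roots: its determinant
  is \<open>1 - cos\<^sup>2 (\<pi> / k) > 0\<close>.
\<close>

lemma dihedral_decomposition:
  assumes "s \<in> S" "t \<in> S" "s \<noteq> t" "m s t = enat k"
  obtains p q v0 where "v = comb 1 v0 1 (comb p (simple_root s) q (simple_root t))"
    "pairing s v0 = 0" "pairing t v0 = 0"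
proof -
  define g where "g = gram s t"
  have "sin (pi / real k) > 0" using cheb_finite[OF assms] by blast
  then have "g * g \<noteq> 1"
    using sin_cos_squared_add[of "pi / real k"] assms(4) by (auto simp: g_def gram_def power2_eq_square)
  then have d: "1 - g * g \<noteq> 0" by simp
  define p where "p = (pairing s v - g * pairing t v) / (1 - g * g)"
  define q where "q = (pairing t v - g * pairing s v) / (1 - g * g)"
  define v0 where "v0 = comb 1 v (-1) (comb p (simple_root s) q (simple_root t))"
  have pq: "p + q * g = pairing s v" "p * g + q = pairing t v"
    using d by (simp_all add: p_def q_def divide_simps) (simp_all add: algebra_simps)
  have "v = comb 1 v0 1 (comb p (simple_root s) q (simple_root t))"
    by (simp add: v0_def comb_def)
  moreover have "pairing s v0 = 0" "pairing t v0 = 0"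
    using assms gram_sym[of s t] pq unfolding v0_def
    by (simp_all add: pairing_comb pairing_simple_root gram_diag flip: g_def)
  ultimately show ?thesis by (rule that)
qed

text \<open>
  The two words agree on the plane of the two simple roots by the computation above, and both fix its
  orthogonal complement.
\<close>

lemma braid_rho:
  assumes "s \<in> S" "t \<in> S" "s \<noteq> t" "m s t = enat k"
  shows "rho (alternating s t k) = rho (alternating t s k)"
proof
  fix v
  obtain p q v0 where v: "v = comb 1 v0 1 (comb p (simple_root s) q (simple_root t))"
    and v0: "pairing s v0 = 0" "pairing t v0 = 0"
    using dihedral_decomposition[OF assms] .
  have fixed: "rho ws v0 = v0" if "set ws \<subseteq> {s, t}" for ws
    using that v0 by (induction ws) (auto simp: reflect_def comb_def)
  have "m t s = enat k" using assms m_sym by metis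
  note l = longest_alternating[OF assms] longest_alternating[OF assms(2,1) assms(3)[symmetric] this]
  have "rho (alternating s t k) (simple_root x) = rho (alternating t s k) (simple_root x)" if "x \<in> {s, t}" for x
    using l that by (cases "even k") auto
  then show "rho (alternating s t k) v = rho (alternating t s k) v"
    unfolding v rho_comb using fixed[OF set_alternating[of s t k]] fixed[of "alternating t s k"] set_alternating[of t s k]
    by (simp add: insert_commute)
qed

end

context coxeter
begin

subsection \<open>Every root is positive or negative\<close>

text \<open>
  Word length in the reflection group, where two words count as equal when they are the same linear map.
\<close>

definition len :: "('a vec \<Rightarrow> 'a vec) \<Rightarrow> nat" where
  "len u = (LEAST n. \<exists>ws\<in>lists S. rho ws = u \<and> length ws = n)"

lemma len_attained:
  assumes "ws \<in> lists S"
  obtains vs where "vs \<in> lists S" "rho vs = rho ws" "length vs = len (rho ws)"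
proof -
  have "\<exists>n. \<exists>vs\<in>lists S. rho vs = rho ws \<and> length vs = n" using assms by blast
  from LeastI_ex[OF this] show ?thesis using that unfolding len_def by blast
qed

lemma len_le: "ws \<in> lists S \<Longrightarrow> len (rho ws) \<le> length ws"
  unfolding len_def by (rule Least_le) blast

lemma len_append:
  assumes "v \<in> lists S" "u \<in> lists S"
  shows "len (rho (v @ u)) \<le> len (rho v) + length u"
proof -
  obtain v' where "v' \<in> lists S" "rho v' = rho v" "length v' = len (rho v)"
    using assms len_attained by blast
  moreover have "rho (v @ u) = rho (v' @ u)"
    unfolding rho_append \<open>rho v' = rho v\<close> ..
  ultimately show ?thesis using len_le[of "v' @ u"] assms by simp
qed

lemma nonneg_simple_root: "nonneg (simple_root s)"
  by (simp add: nonneg_def simple_root_def)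

lemma nonneg_comb: "nonneg v \<Longrightarrow> nonneg w \<Longrightarrow> 0 \<le> p \<Longrightarrow> 0 \<le> q \<Longrightarrow> nonneg (comb p v q w)"
  by (simp add: nonneg_def comb_def)

lemma cheb_nonneg:
  assumes "s \<in> S" "t \<in> S" "s \<noteq> t" "enat j \<le> m s t"
  shows "0 \<le> cheb (- 2 * gram s t) j"
proof (cases "j = 0 \<or> m s t = enat j")
  case True
  then show ?thesis using cheb_order(1)[OF assms(1-3)] by auto
next
  case False
  then have "0 < j" "enat j < m s t" using assms(4) by auto
  from cheb_pos[OF assms(1-3) this] show ?thesis by (rule less_imp_le)
qed

lemma rho_cancel: "a \<in> S \<Longrightarrow> rho (p @ a # a # q) = rho (p @ q)"
  by (auto simp: rho_append fun_eq_iff)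

text \<open>
  The induction is on the length of \<open>rho ws\<close>, which is split as \<open>v u\<close> with lengths adding up and \<open>u\<close>
  a word in \<open>s\<close> and \<open>t\<close> of maximal length, where \<open>t\<close> is the last letter of some reduced word. By
  maximality neither \<open>s\<close> nor \<open>t\<close> shortens \<open>v\<close> on the right, so \<open>v\<close> sends both simple roots to nonnegative
  vectors. By minimal length \<open>u\<close> alternates, and as \<open>s\<close> does not shorten \<open>rho ws\<close>, it ends with \<open>t\<close>
  and is shorter than \<open>m s t\<close>. Hence it sends the simple root of \<open>s\<close> to a nonnegative
  combination of the two simple roots.
\<close>

lemma nonneg_if_len_le:
  assumes "ws \<in> lists S" "s \<in> S" "len (rho ws) \<le> len (rho (ws @ [s]))"
  shows "nonneg (rho ws (simple_root s))"
  using assms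
proof (induction "len (rho ws)" arbitrary: ws s rule: less_induct)
  case less
  define n where "n = len (rho ws)"
  have shorter: False if "v \<in> lists S" "u \<in> lists S" "rho (ws @ [s]) = rho (v @ u)"
    "len (rho v) + length u < n" for v u
    using len_append[OF that(1,2)] that(3,4) less.prems(3) n_def by simp
  obtain vs where vs: "vs \<in> lists S" "rho vs = rho ws" "length vs = n"
    using len_attained[OF less.prems(1)] n_def by blast
  show ?case
  proof (cases vs rule: rev_cases)
    case Nil
    then have "rho ws = id" using vs by auto
    then show ?thesis by (simp add: nonneg_simple_root)
  next
    case (snoc v0 t)
    have t: "t \<in> S" "v0 \<in> lists S" using snoc vs by auto
    have "t \<noteq> s"
    proof
      assume "t = s"
      have "rho (ws @ [s]) = rho (vs @ [s])" by (simp only: rho_append vs(2))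
      also have "\<dots> = rho (v0 @ [])"
        using rho_cancel[OF less.prems(2), of v0 "[]"] snoc \<open>t = s\<close> by simp
      finally show False
        using shorter[of v0 "[]"] t vs(3) snoc len_le[of v0] by simp
    qed
    define dec where "dec k \<longleftrightarrow> (\<exists>v u. v \<in> lists S \<and> u \<in> lists {s, t} \<and> rho (v @ u) = rho ws
        \<and> len (rho v) + length u \<le> n \<and> length u = k)" for k
    have "dec 1"
      unfolding dec_def using t vs snoc len_le[of v0]
      by (intro exI[of _ v0] exI[of _ "[t]"]) auto
    moreover have bound: "\<forall>k. dec k \<longrightarrow> k \<le> n" unfolding dec_def by auto
    ultimately obtain k where k: "dec k" "\<And>j. dec j \<Longrightarrow> j \<le> k"
      using GreatestI_nat[of dec 1 n] Greatest_le_nat[of dec _ n] by metis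
    have "k \<ge> 1" using k(2) \<open>dec 1\<close> by blast
    obtain v u where vu: "v \<in> lists S" "u \<in> lists {s, t}" "rho (v @ u) = rho ws"
      "len (rho v) + length u \<le> n" "length u = k"
      using k(1) unfolding dec_def by blast
    have st: "s \<in> S" "t \<in> S" "{s, t} \<subseteq> S" using t less.prems(2) by auto
    have uS: "u \<in> lists S" using vu(2) st(3) by auto
    have pos: "nonneg (rho v (simple_root r))" if r: "r \<in> {s, t}" for r
    proof (rule less.hyps)
      show "len (rho v) < len (rho ws)" using vu(4,5) \<open>k \<ge> 1\<close> n_def by simp
      show "r \<in> S" using r st by auto
      show "len (rho v) \<le> len (rho (v @ [r]))"
      proof (rule ccontr)
        assume "\<not> ?thesis"
        then have "dec (Suc k)"
          unfolding dec_def using vu r \<open>r \<in> S\<close> rho_cancel[of r v u]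
          by (intro exI[of _ "v @ [r]"] exI[of _ "r # u"]) auto
        then show False using k(2) by fastforce
      qed
    qed (rule vu(1))
    \<comment> \<open>Three ways to contradict minimality: shortening \<open>u\<close>, writing \<open>u\<close> with last letter \<open>s\<close>, and writing
      a final segment of \<open>u\<close> as an alternating word with last letter \<open>s\<close>.\<close>
    have reduced: False if "w \<in> lists S" "rho w = rho u" "length w < length u" for w
      using len_append[of v w] vu that n_def rho_append[of v w] rho_append[of v u] by simp
    have no_s: False if "p \<in> lists S" "rho (p @ [s]) = rho u" "length p < length u" for p
    proof -
      have "rho (ws @ [s]) = rho v \<circ> (rho (p @ [s]) \<circ> rho [s])"
        by (simp only: rho_append[of ws] vu(3)[symmetric] rho_append[of v] that(2) comp_assoc)
      also have "rho (p @ [s]) \<circ> rho [s] = rho p"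
        using rho_cancel[OF st(1), of p "[]"] rho_append[of "p @ [s]" "[s]"] by simp
      finally have "rho (ws @ [s]) = rho (v @ p)" by (simp only: rho_append)
      then show False using shorter[of v p] vu that by simp
    qed
    have "distinct_adj u"
    proof (rule ccontr)
      assume "\<not> distinct_adj u"
      then obtain p a q where u: "u = p @ a # a # q" using not_distinct_adj_split by blast
      then show False using reduced[of "p @ q"] rho_cancel[of a p q] uS by simp
    qed
    then obtain i where "u = alternating s t i \<or> u = alternating t s i"
      using distinct_adj_alternating[OF _ vu(2)] by blast
    then have "u = alternating s t k \<or> u = alternating t s k"
      using vu(5) by auto
    then obtain a b where ab: "u = alternating a b k" "{a, b} = {s, t}"
      by (metis insert_commute)
    have abS: "a \<in> S" "b \<in> S" "a \<noteq> b" using ab(2) st \<open>t \<noteq> s\<close> by (auto simp: doubleton_eq_iff)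
    have altS: "alternating c d j \<in> lists S" if "{c, d} = {s, t}" for c d j
      using set_alternating[of c d j] that st by (auto simp: in_lists_conv_set)
    have last_not_s: False if "rho (p @ alternating c d (Suc j)) = rho u" "p \<in> lists S"
      "{c, d} = {s, t}" "(if even j then c else d) = s" "length p + Suc j = k" for p c d j
      using no_s[of "p @ alternating c d j"] that altS[OF that(3)] vu(5)
      by (simp add: alternating_snoc del: foldr_append)
    obtain j where j: "k = Suc j" using \<open>k \<ge> 1\<close> by (cases k) auto
    have next_s: "(if even k then a else b) = s"
      using last_not_s[of "[]" a b j] ab j by (auto simp: doubleton_eq_iff split: if_splits)
    have "enat k < m a b"
    proof (rule ccontr)
      assume "\<not> enat k < m a b"
      then obtain i where i: "m a b = enat i" "i \<le> k" by (cases "m a b") auto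
      obtain i' where i': "i = Suc i'" using finite_order_ge2[OF abS i(1)] by (cases i) auto
      \<comment> \<open>The last \<open>m a b\<close> letters form a longest alternating word, which can be replaced by the other
        one; that one ends with \<open>s\<close>.\<close>
      let ?c = "if even (k - i) then a else b" and ?d = "if even (k - i) then b else a"
      have u: "u = alternating a b (k - i) @ alternating ?c ?d i"
        using alternating_add[of a b "k - i" i] i(2) ab(1) by simp
      have cd: "?c \<in> S" "?d \<in> S" "?c \<noteq> ?d" "m ?c ?d = enat i" "{?d, ?c} = {s, t}"
        using abS i(1) m_sym[of a b] ab(2) by auto
      have "rho u = rho (alternating a b (k - i) @ alternating ?d ?c i)"
        using braid_rho[OF cd(1-4)] unfolding u by (simp only: rho_append)
      moreover have "(if even i' then ?d else ?c) = s"
        using next_s i(2) i' by (auto split: if_splits)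
      ultimately show False
        using last_not_s[of "alternating a b (k - i)" ?d ?c i'] cd(5) altS[OF ab(2)] i(2) i' by simp
    qed
    then have "0 \<le> cheb (- 2 * gram a b) (Suc k)" "0 \<le> cheb (- 2 * gram a b) k"
      using cheb_nonneg[OF abS, of "Suc k"] cheb_nonneg[OF abS, of k] by (simp_all add: Suc_ile_eq)
    moreover have "rho u (simple_root s)
        = comb (cheb (- 2 * gram a b) (Suc k)) (simple_root a) (cheb (- 2 * gram a b) k) (simple_root b)"
      using rho_alternating[OF abS, of k] next_s ab(1) by simp
    moreover have "a \<in> {s, t}" "b \<in> {s, t}" using ab(2) by auto
    moreover have "rho ws (simple_root s) = rho v (rho u (simple_root s))"
      by (simp flip: vu(3) add: rho_append)
    ultimately show ?thesis
      using pos by (simp add: rho_comb nonneg_comb del: cheb.simps)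
  qed
qed

text \<open>
  The previous lemma applies to the shorter of \<open>rho ws\<close> and \<open>rho (ws @ [s])\<close>, and these two send the simple
  root of \<open>s\<close> to opposite vectors.
\<close>

theorem root_nonneg_or_nonpos:
  assumes "ws \<in> lists S" "s \<in> S"
  shows "nonneg (rho ws (simple_root s)) \<or> nonpos (rho ws (simple_root s))"
proof (cases "len (rho ws) \<le> len (rho (ws @ [s]))")
  case True
  then show ?thesis using nonneg_if_len_le assms by blast
next
  case False
  have "rho ((ws @ [s]) @ [s]) = rho ws" using rho_cancel[OF assms(2), of ws "[]"] by simp
  then have "nonneg (rho (ws @ [s]) (simple_root s))"
    using False assms by (intro nonneg_if_len_le) auto
  then have "nonneg (comb (-1) (rho ws (simple_root s)) 0 (rho ws (simple_root s)))"
    using assms by (simp add: rho_append reflect_simple_root rho_comb)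
  then show ?thesis by (simp add: nonneg_def nonpos_def comb_def)
qed

end

section \<open>Parabolic subgroups of Artin-Tits groups\<close>

text \<open>
  The permutations \<open>g\<close> form an action of the Artin-Tits group with generators \<open>X\<close>, which is to be extended to
  the generators in \<open>S\<close>.
\<close>

locale parabolic = coxeter S m for S :: "'a set" and m +
  fixes X :: "'a set" and g :: "'a \<Rightarrow> 'c \<Rightarrow> 'c"
  assumes X_subset: "X \<subseteq> S"
    and bij_g: "x \<in> X \<Longrightarrow> bij (g x)"
    and braid_g: "x \<in> X \<Longrightarrow> y \<in> X \<Longrightarrow> x \<noteq> y \<Longrightarrow> m x y = enat k \<Longrightarrow>
      foldr g (alternating x y k) = foldr g (alternating y x k)"
begin

text \<open>
  The shortest representatives of the cosets \<open>u W\<^bsub>X\<^esub>\<close> in the Coxeter group, characterised by their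
  action on roots.
\<close>

definition chambers :: "('a vec \<Rightarrow> 'a vec) set" where
  "chambers = {u. (\<exists>ws\<in>lists S. u = rho ws) \<and> (\<forall>x\<in>X. nonneg (u (simple_root x)))}"

text \<open>
  Left multiplication by \<open>a\<close> changes the coset, except when the reflection in \<open>a\<close> is conjugate by \<open>u\<close> to
  that of some \<open>x \<in> X\<close>. Then \<open>a u = u x\<close> lies in the same coset, and the factor \<open>x\<close> is recorded in the first
  component by means of \<open>g\<close>.
\<close>

definition step :: "'a \<Rightarrow> 'c \<times> ('a vec \<Rightarrow> 'a vec) \<Rightarrow> 'c \<times> ('a vec \<Rightarrow> 'a vec)" where
  "step a = (\<lambda>(c, u).
     if u \<notin> chambers then (c, u)
     else if \<exists>x\<in>X. u (simple_root x) = simple_root a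
     then (g (SOME x. x \<in> X \<and> u (simple_root x) = simple_root a) c, u)
     else (c, reflect a \<circ> u))"

lemma chambers_inj:
  assumes "u \<in> chambers" "u (simple_root x) = u (simple_root y)"
  shows "x = y"
proof -
  obtain ws where ws: "ws \<in> lists S" "u = rho ws"
    using assms(1) unfolding chambers_def by blast
  have "simple_root x = rho (rev ws) (u (simple_root x))"
    using ws by (simp add: rho_rev)
  also have "\<dots> = simple_root y"
    unfolding assms(2) using ws by (simp add: rho_rev)
  finally show ?thesis by (simp add: simple_root_inj)
qed

lemma step_loop:
  assumes "u \<in> chambers" "x \<in> X" "u (simple_root x) = simple_root a"
  shows "step a (c, u) = (g x c, u)"
proof -
  have "(SOME x. x \<in> X \<and> u (simple_root x) = simple_root a) = x"
    using assms chambers_inj by (intro some_equality) auto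
  with assms show ?thesis by (auto simp: step_def)
qed

lemma step_move:
  assumes "u \<in> chambers" "\<forall>x\<in>X. u (simple_root x) \<noteq> simple_root a"
  shows "step a (c, u) = (c, reflect a \<circ> u)"
  using assms by (auto simp: step_def)

lemma step_outside: "u \<notin> chambers \<Longrightarrow> step a (c, u) = (c, u)"
  by (simp add: step_def)

lemma chambers_form: "u \<in> chambers \<Longrightarrow> form (u v) (u w) = form v w"
  using form_rho unfolding chambers_def by blast

lemma form_simple_root_self: "s \<in> S \<Longrightarrow> form (simple_root s) (simple_root s) = 1"
  by (simp add: form_simple_root pairing_simple_root gram_diag)

text \<open>
  Roots have norm one.
\<close>

lemma root_multiple:
  assumes "u \<in> chambers" "x \<in> X" "a \<in> S" "u (simple_root x) = comb p (simple_root a) 0 w"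
  shows "u (simple_root x) = simple_root a"
proof -
  have "form (u (simple_root x)) (u (simple_root x)) = 1"
    using chambers_form[OF assms(1), of "simple_root x" "simple_root x"]
      form_simple_root_self[of x] assms(2) X_subset by auto
  then have "p * p = 1"
    using assms(3) unfolding assms(4) by (simp add: form_comb_left form_comb_right form_simple_root_self)
  moreover have "0 \<le> u (simple_root x) a"
    using assms(1,2) unfolding chambers_def nonneg_def by blast
  then have "0 \<le> p" unfolding assms(4) by (simp add: comb_def simple_root_def)
  ultimately have "p = 1" by (simp add: square_eq_1_iff)
  then show ?thesis using assms(4) by (simp add: comb_def)
qed

text \<open>
  The reflection in \<open>a\<close> only changes the coordinate at \<open>a\<close>. So the only way for it to make a positive root
  negative is that this root is a multiple of the simple root of \<open>a\<close>, and then it equals it.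
\<close>

lemma move_chambers:
  assumes u: "u \<in> chambers" and a: "a \<in> S" and no: "\<forall>x\<in>X. u (simple_root x) \<noteq> simple_root a"
  shows "reflect a \<circ> u \<in> chambers" "\<forall>x\<in>X. (reflect a \<circ> u) (simple_root x) \<noteq> simple_root a"
proof -
  obtain ws where ws: "ws \<in> lists S" "u = rho ws" using u by (auto simp: chambers_def)
  have nn: "nonneg (u (simple_root x))" if "x \<in> X" for x
    using u that by (auto simp: chambers_def)
  have "nonneg ((reflect a \<circ> u) (simple_root x))" if x: "x \<in> X" for x
  proof (rule ccontr)
    assume "\<not> ?thesis"
    moreover have "nonneg (rho (a # ws) (simple_root x)) \<or> nonpos (rho (a # ws) (simple_root x))"
      using root_nonneg_or_nonpos[of "a # ws" x] ws a x X_subset by auto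
    ultimately have np: "nonpos (reflect a (u (simple_root x)))" using ws by simp
    have "u (simple_root x) r = 0" if "r \<noteq> a" for r
    proof -
      have "reflect a (u (simple_root x)) r = u (simple_root x) r"
        using that by (simp add: reflect_def comb_def simple_root_def)
      then show ?thesis
        using np nn[OF x] unfolding nonneg_def nonpos_def by (metis order_antisym)
    qed
    then have "u (simple_root x) = comb (u (simple_root x) a) (simple_root a) 0 (simple_root a)"
      by (auto simp: comb_def simple_root_def fun_eq_iff)
    from root_multiple[OF u x a this] show False using no x by blast
  qed
  then show "reflect a \<circ> u \<in> chambers"
    using ws a unfolding chambers_def by (auto intro!: bexI[of _ "a # ws"])
  show "\<forall>x\<in>X. (reflect a \<circ> u) (simple_root x) \<noteq> simple_root a"
  proof (intro ballI notI)
    fix x assume x: "x \<in> X" "(reflect a \<circ> u) (simple_root x) = simple_root a"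
    then have "u (simple_root x) = reflect a (simple_root a)"
      using a by (metis comp_apply reflect_reflect)
    then have "u (simple_root x) a = -1"
      unfolding reflect_simple_root[OF a] by (simp add: comb_def simple_root_def)
    then show False using nn[OF x(1)] unfolding nonneg_def by (metis neg_0_le_iff_le not_one_le_zero)
  qed
qed

lemma bij_step:
  assumes a: "a \<in> S"
  shows "bij (step a)"
proof -
  define h where "h = (\<lambda>(c, u).
     if u \<notin> chambers then (c, u)
     else if \<exists>x\<in>X. u (simple_root x) = simple_root a
     then (inv_into UNIV (g (SOME x. x \<in> X \<and> u (simple_root x) = simple_root a)) c, u)
     else (c, reflect a \<circ> u))"
  have h_loop: "h (c, u) = (inv_into UNIV (g x) c, u)"
    if "u \<in> chambers" "x \<in> X" "u (simple_root x) = simple_root a" for c u x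
  proof -
    have "(SOME x. x \<in> X \<and> u (simple_root x) = simple_root a) = x"
      using that chambers_inj by (intro some_equality) auto
    with that show ?thesis by (auto simp: h_def)
  qed
  have h_move: "h (c, u) = (c, reflect a \<circ> u)"
    if "u \<in> chambers" "\<forall>x\<in>X. u (simple_root x) \<noteq> simple_root a" for c u
    using that by (auto simp: h_def)
  have rr: "reflect a \<circ> (reflect a \<circ> u) = u" for u
    using a by (auto simp: fun_eq_iff)
  have "h (step a (c, u)) = (c, u) \<and> step a (h (c, u)) = (c, u)" for c u
  proof (cases "u \<in> chambers")
    case False
    then show ?thesis by (simp add: step_def h_def)
  next
    case u: True
    show ?thesis
    proof (cases "\<exists>x\<in>X. u (simple_root x) = simple_root a")
      case True
      then obtain x where x: "x \<in> X" "u (simple_root x) = simple_root a" by blast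
      then show ?thesis
        using h_loop[OF u x] step_loop[OF u x] bij_g[OF x(1)]
        by (simp add: bij_is_surj surj_f_inv_f bij_is_inj inv_f_f)
    next
      case False
      then have no: "\<forall>x\<in>X. u (simple_root x) \<noteq> simple_root a" by blast
      note mv = move_chambers[OF u a no]
      show ?thesis
        by (simp only: step_move[OF u no] h_move[OF u no] step_move[OF mv] h_move[OF mv] rr simp_thms)
    qed
  qed
  then have "h \<circ> step a = id" "step a \<circ> h = id" by auto
  then show ?thesis by (rule o_bij)
qed

subsection \<open>The braid relations for the extended action\<close>

text \<open>
  The walk that starts at \<open>u\<close> and reads \<open>w\<close> from its last letter on never stays in place.
\<close>

definition free_walk :: "'a list \<Rightarrow> ('a vec \<Rightarrow> 'a vec) \<Rightarrow> bool" where
  "free_walk w u \<longleftrightarrow> (\<forall>p a q. w = p @ a # q \<longrightarrow> (\<forall>x\<in>X. rho q (u (simple_root x)) \<noteq> simple_root a))"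

lemma free_walk_Cons:
  "free_walk (a # w) u \<longleftrightarrow> free_walk w u \<and> (\<forall>x\<in>X. rho w (u (simple_root x)) \<noteq> simple_root a)"
  unfolding free_walk_def by (auto simp: Cons_eq_append_conv)

lemma walk_free:
  assumes "u \<in> chambers" "w \<in> lists S" "free_walk w u"
  shows "foldr step w (c, u) = (c, rho w \<circ> u)" "rho w \<circ> u \<in> chambers"
proof -
  have "foldr step w (c, u) = (c, rho w \<circ> u) \<and> rho w \<circ> u \<in> chambers"
    using assms(2,3)
  proof (induction w)
    case Nil
    then show ?case using assms(1) by (simp add: id_def comp_def)
  next
    case (Cons a w)
    then have w: "free_walk w u" and no: "\<forall>x\<in>X. (rho w \<circ> u) (simple_root x) \<noteq> simple_root a"
      by (auto simp: free_walk_Cons)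
    have IH: "foldr step w (c, u) = (c, rho w \<circ> u)" "rho w \<circ> u \<in> chambers"
      using Cons.IH[OF w] by blast+
    have "reflect a \<circ> (rho w \<circ> u) = rho (a # w) \<circ> u" by (simp add: comp_assoc)
    then show ?case
      using step_move[OF IH(2) no, of c] move_chambers(1)[OF IH(2) _ no] Cons.hyps(1)
      by (simp only: foldr_Cons[of step] comp_apply[of "step a"] IH(1) simp_thms)
  qed
  then show "foldr step w (c, u) = (c, rho w \<circ> u)" "rho w \<circ> u \<in> chambers" by auto
qed

lemma first_loop:
  assumes "\<not> free_walk w u"
  obtains p a q x where "w = p @ a # q" "free_walk q u" "x \<in> X" "rho q (u (simple_root x)) = simple_root a"
proof -
  have "\<exists>p a q x. w = p @ a # q \<and> free_walk q u \<and> x \<in> X \<and> rho q (u (simple_root x)) = simple_root a"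
    using assms
  proof (induction w)
    case Nil
    then show ?case by (simp add: free_walk_def)
  next
    case (Cons a w)
    show ?case
    proof (cases "free_walk w u")
      case True
      with Cons.prems show ?thesis by (fastforce simp: free_walk_Cons)
    next
      case False
      then obtain p b q x where "w = p @ b # q" "free_walk q u" "x \<in> X"
        "rho q (u (simple_root x)) = simple_root b" using Cons.IH by blast
      then show ?thesis by (intro exI[of _ "a # p"]) auto
    qed
  qed
  then show ?thesis using that by blast
qed

definition plane :: "'a \<Rightarrow> 'a \<Rightarrow> 'a vec set" where
  "plane s t = {comb p (simple_root s) q (simple_root t) | p q. True}"

lemma plane_sym: "plane s t = plane t s"
proof -
  have "comb p v q w = comb q w p v" for p q and v w :: "'a vec"
    by (simp add: comb_def add.commute)
  then show ?thesis unfolding plane_def by blast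
qed

lemma simple_root_plane: "simple_root s \<in> plane s t"
proof -
  have "simple_root s = comb 1 (simple_root s) 0 (simple_root t)" by (simp add: comb_def)
  then show ?thesis unfolding plane_def by blast
qed

lemma reflect_plane: "v \<in> plane s t \<Longrightarrow> reflect s v \<in> plane s t"
proof -
  assume "v \<in> plane s t"
  then obtain p q where v: "v = comb p (simple_root s) q (simple_root t)" by (auto simp: plane_def)
  have "reflect s v = comb (p - 2 * pairing s v) (simple_root s) q (simple_root t)"
    unfolding reflect_def by (subst v) (simp add: comb_def algebra_simps)
  then show ?thesis unfolding plane_def by blast
qed

lemma rho_plane: "set w \<subseteq> {s, t} \<Longrightarrow> v \<in> plane s t \<Longrightarrow> rho w v \<in> plane s t"
proof (induction w)
  case (Cons a w)
  then show ?case using reflect_plane[of _ s t] reflect_plane[of _ t s] plane_sym[of s t] by auto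
qed simp

text \<open>
  A walk with letters \<open>s\<close> and \<open>t\<close> can only stay in place because of simple roots of \<open>X\<close> that
  \<open>u\<close> maps into the plane of \<open>s\<close> and \<open>t\<close>.
\<close>

lemma loop_plane:
  assumes "s \<in> S" "t \<in> S" "set q \<subseteq> {s, t}" "a \<in> {s, t}" "rho q v = simple_root a"
  shows "v \<in> plane s t"
proof -
  have "q \<in> lists S" using assms by auto
  then have "v = rho (rev q) (simple_root a)" using rho_rev assms(5) by metis
  moreover have "simple_root a \<in> plane s t"
    using assms(4) simple_root_plane[of s t] simple_root_plane[of t s] plane_sym[of s t] by auto
  ultimately show ?thesis using rho_plane[of "rev q" s t] assms(3) by simp
qed

lemma reflect_conj:
  assumes "u \<in> chambers" "x \<in> S" "a \<in> S" "u (simple_root x) = simple_root a"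
  shows "reflect a \<circ> u = u \<circ> reflect x"
proof
  fix v
  obtain ws where ws: "u = rho ws" using assms(1) by (auto simp: chambers_def)
  have "pairing a (u v) = pairing x v"
    using chambers_form[OF assms(1), of v "simple_root x"] assms by (simp add: form_simple_root)
  then show "(reflect a \<circ> u) v = (u \<circ> reflect x) v"
    using assms(4) by (simp add: reflect_def ws rho_comb)
qed

text \<open>
  If the plane of \<open>s\<close> and \<open>t\<close> contains the images of two simple roots of \<open>X\<close>, then these are exactly
  the two simple roots of the plane. For the inverse of \<open>u\<close> maps the simple roots of \<open>s\<close> and \<open>t\<close> to roots, so their
  coordinates at \<open>x\<close> and \<open>y\<close> do not have opposite signs, while the inverse matrix
  is nonnegative because \<open>u\<close> preserves positivity at \<open>x\<close> and \<open>y\<close>. A nonnegative invertible matrix whose inverse has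
  no row with two entries of opposite signs is diagonal or antidiagonal, and its nonzero entries are \<open>1\<close> because
  roots have norm one.
\<close>

lemma two_in_plane:
  assumes u: "u \<in> chambers" and st: "s \<in> S" "t \<in> S" "s \<noteq> t"
    and xy: "x \<in> X" "y \<in> X" "x \<noteq> y" "u (simple_root x) \<in> plane s t" "u (simple_root y) \<in> plane s t"
  shows "u (simple_root x) = simple_root s \<and> u (simple_root y) = simple_root t
    \<or> u (simple_root x) = simple_root t \<and> u (simple_root y) = simple_root s"
proof -
  obtain ws where ws: "ws \<in> lists S" "u = rho ws" using u by (auto simp: chambers_def)
  obtain p q p' q' where ux: "u (simple_root x) = comb p (simple_root s) q (simple_root t)"
    and uy: "u (simple_root y) = comb p' (simple_root s) q' (simple_root t)"
    using xy by (auto simp: plane_def)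
  have nn: "nonneg (u (simple_root x))" "nonneg (u (simple_root y))"
    using u xy by (auto simp: chambers_def)
  have "0 \<le> u (simple_root x) s" "0 \<le> u (simple_root x) t" "0 \<le> u (simple_root y) s" "0 \<le> u (simple_root y) t"
    using nn unfolding nonneg_def by blast+
  then have pos: "0 \<le> p" "0 \<le> q" "0 \<le> p'" "0 \<le> q'"
    using st(3) unfolding ux uy by (simp_all add: comb_def simple_root_def)
  define a where "a = rho (rev ws) (simple_root s)"
  define b where "b = rho (rev ws) (simple_root t)"
  have rx: "simple_root x = comb p a q b" and ry: "simple_root y = comb p' a q' b"
    using rho_rev[OF ws(1), of "simple_root x"] rho_rev[OF ws(1), of "simple_root y"] ux uy
    unfolding ws(2) a_def b_def by (simp_all add: rho_comb)
  have rl: "rev ws \<in> lists S" using ws(1) by (auto simp: in_lists_conv_set)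
  have ab: "0 \<le> a x * a y" "0 \<le> b x * b y"
    using root_nonneg_or_nonpos[OF rl st(1)] root_nonneg_or_nonpos[OF rl st(2)]
    unfolding a_def[symmetric] b_def[symmetric] nonneg_def nonpos_def
    by (auto intro: mult_nonneg_nonneg mult_nonpos_nonpos)
  have eqs: "p * a x + q * b x = 1" "p' * a x + q' * b x = 0" "p * a y + q * b y = 0" "p' * a y + q' * b y = 1"
    using fun_cong[OF rx, of x] fun_cong[OF rx, of y] fun_cong[OF ry, of x] fun_cong[OF ry, of y] xy(3)
    by (simp_all add: comb_def simple_root_def split: if_splits)
  \<comment> \<open>Cramer's rule for the matrix with rows \<open>(p, q)\<close> and \<open>(p', q')\<close>.\<close>
  define d where "d = p * q' - p' * q"
  have "d * a x = q' * (p * a x + q * b x) - q * (p' * a x + q' * b x)"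
       "d * a y = q' * (p * a y + q * b y) - q * (p' * a y + q' * b y)"
       "d * b x = p * (p' * a x + q' * b x) - p' * (p * a x + q * b x)"
       "d * b y = p * (p' * a y + q' * b y) - p' * (p * a y + q * b y)"
    unfolding d_def by (simp_all add: algebra_simps)
  then have d: "d * a x = q'" "d * a y = - q" "d * b x = - p'" "d * b y = p"
    by (simp_all add: eqs)
  have "- (q' * q) = (d * a x) * (d * a y)" "- (p' * p) = (d * b x) * (d * b y)"
    unfolding d by simp_all
  then have "- (q' * q) = (d * d) * (a x * a y)" "- (p' * p) = (d * d) * (b x * b y)"
    by (simp_all only: ac_simps)
  then have "q' * q \<le> 0" "p' * p \<le> 0"
    using ab by (metis mult_nonneg_nonneg neg_0_le_iff_le zero_le_square)+
  then have "q' * q = 0" "p' * p = 0" using pos by (meson mult_nonneg_nonneg order_antisym)+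
  moreover have "\<not> (p = 0 \<and> q = 0)" "\<not> (p' = 0 \<and> q' = 0)" using eqs by auto
  ultimately consider "q = 0" "p' = 0" | "p = 0" "q' = 0" by auto
  then show ?thesis
  proof cases
    case 1
    then have "u (simple_root x) = comb p (simple_root s) 0 (simple_root t)"
      "u (simple_root y) = comb q' (simple_root t) 0 (simple_root s)"
      using ux uy by (simp_all add: comb_def)
    then show ?thesis using root_multiple[OF u] xy st by metis
  next
    case 2
    then have "u (simple_root x) = comb q (simple_root t) 0 (simple_root s)"
      "u (simple_root y) = comb p' (simple_root s) 0 (simple_root t)"
      using ux uy by (simp_all add: comb_def)
    then show ?thesis using root_multiple[OF u] xy st by metis
  qed
qed

lemma loops_only:
  assumes "u \<in> chambers" "x \<in> X" "y \<in> X" "u (simple_root x) = simple_root s" "u (simple_root y) = simple_root t"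
  shows "foldr step (alternating s t k) (c, u) = (foldr g (alternating x y k) c, u)"
  using assms
proof (induction k arbitrary: s t x y)
  case (Suc k)
  then show ?case using Suc.IH[of y x t s] step_loop by (simp add: alternating_Suc)
qed simp

text \<open>
  Here the walk never leaves \<open>u\<close>, and the relation between \<open>s\<close> and \<open>t\<close> becomes the relation between \<open>x\<close>
  and \<open>y\<close>, which has the same length because \<open>u\<close> is an isometry.
\<close>

lemma braid_step_two:
  assumes u: "u \<in> chambers" and st: "s \<in> S" "t \<in> S" "s \<noteq> t" "m s t = enat k"
    and xy: "x \<in> X" "y \<in> X" "u (simple_root x) = simple_root s" "u (simple_root y) = simple_root t"
  shows "foldr step (alternating s t k) (c, u) = foldr step (alternating t s k) (c, u)"
proof -
  have "x \<noteq> y" using st(3) xy simple_root_inj by metis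
  have S: "x \<in> S" "y \<in> S" using xy X_subset by auto
  have "gram x y = gram s t"
    using chambers_form[OF u, of "simple_root x" "simple_root y"] xy st S
    by (simp add: form_simple_root pairing_simple_root)
  then have "m x y = enat k" using gram_determines_order st S \<open>x \<noteq> y\<close> by blast
  then show ?thesis
    using loops_only[OF u xy] loops_only[OF u xy(2,1,4,3)] braid_g[OF xy(1,2) \<open>x \<noteq> y\<close>] by simp
qed

lemma alternating_two_split:
  assumes "alternating s t k = p1 @ b # p2 @ a # q"
  obtains b' where "{b', b} = {s, t}" "p2 = alternating b' b (length p2)"
    "a = (if even (length p2) then b' else b)"
proof -
  let ?i = "length p1" and ?j = "Suc (length (p2 @ a # q))"
  have "k = ?i + ?j" using arg_cong[OF assms, of length] by simp
  define c where "c = (if even ?i then s else t)"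
  define d where "d = (if even ?i then t else s)"
  have "alternating s t ?i @ alternating c d ?j = p1 @ b # p2 @ a # q"
    using assms alternating_add[of s t ?i ?j] \<open>k = _\<close> unfolding c_def d_def by metis
  then have "alternating c d ?j = b # p2 @ a # q" by simp
  then have b: "c = b" "alternating d c (length (p2 @ a # q)) = p2 @ a # q"
    by (auto simp only: alternating_Suc list.inject)
  show ?thesis
  proof (rule that[of d])
    show "{d, b} = {s, t}" using b(1) by (auto simp: c_def d_def)
    show "p2 = alternating d b (length p2)" "a = (if even (length p2) then d else b)"
      using alternating_split[OF b(2)] b(1) by auto
  qed
qed

text \<open>
  The walk stays in place exactly once. It does so at least once, as otherwise it would apply the longest
  alternating word to the positive root \<open>u (simple_root x)\<close>, which makes it negative. After the first time
  the root is simple, and it would have to travel through the whole plane, which takes \<open>m s t\<close> letters, to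
  reach the next simple root. The final state is expressed by \<open>s\<close> and \<open>t\<close> only through the longest
  alternating word, which makes it symmetric in the two letters.
\<close>

lemma braid_step_one:
  assumes u: "u \<in> chambers" and st: "s \<in> S" "t \<in> S" "s \<noteq> t" "m s t = enat k"
    and x: "x \<in> X" "u (simple_root x) \<in> plane s t"
    and only: "\<And>y. y \<in> X \<Longrightarrow> u (simple_root y) \<in> plane s t \<Longrightarrow> y = x"
  shows "foldr step (alternating s t k) (c, u) = (g x c, rho (alternating s t k) \<circ> u \<circ> reflect x)"
proof -
  have altS: "set (alternating s t k) \<subseteq> {s, t}" by (rule set_alternating)
  have "\<not> free_walk (alternating s t k) u"
  proof
    assume "free_walk (alternating s t k) u"
    moreover have "alternating s t k \<in> lists S" using altS st by auto
    ultimately have "rho (alternating s t k) \<circ> u \<in> chambers" using walk_free u by blast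
    then have nn': "nonneg (rho (alternating s t k) (u (simple_root x)))" using x by (auto simp: chambers_def)
    obtain p q where pq: "u (simple_root x) = comb p (simple_root s) q (simple_root t)"
      using x by (auto simp: plane_def)
    have nn: "nonneg (u (simple_root x))" using u x by (auto simp: chambers_def)
    have "m t s = enat k" using st m_sym by metis
    note l = longest_alternating(1)[OF st] longest_alternating(2)[OF st(2,1) st(3)[symmetric] this]
    define a where "a = (if even k then s else t)"
    define b where "b = (if even k then t else s)"
    have "rho (alternating s t k) (simple_root a) = comb (-1) (simple_root s) 0 (simple_root t)"
      "rho (alternating s t k) (simple_root b) = comb (-1) (simple_root t) 0 (simple_root s)"
      using l by (simp_all add: a_def b_def)
    moreover have "u (simple_root x) = comb (if even k then p else q) (simple_root a) (if even k then q else p) (simple_root b)"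
      using pq by (auto simp: a_def b_def comb_def)
    ultimately have "rho (alternating s t k) (u (simple_root x))
      = comb (- (if even k then p else q)) (simple_root s) (- (if even k then q else p)) (simple_root t)"
      by (simp add: rho_comb) (simp add: comb_def)
    then have "p \<le> 0 \<and> q \<le> 0"
      using nn' st(3) unfolding nonneg_def
      by (auto simp: comb_def simple_root_def split: if_splits dest: spec[of _ s] spec[of _ t])
    moreover have "p \<ge> 0 \<and> q \<ge> 0"
      using nn st(3) unfolding nonneg_def pq
      by (auto simp: comb_def simple_root_def split: if_splits dest: spec[of _ s] spec[of _ t])
    ultimately have zero: "u (simple_root x) = comb 0 (simple_root s) 0 (simple_root t)" using pq by auto
    from root_multiple[OF u x(1) st(1) this]
    have "simple_root s = comb 0 (simple_root s) 0 (simple_root t)" unfolding zero by (rule HOL.sym)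
    then show False by (simp add: comb_def simple_root_def fun_eq_iff split: if_splits)
  qed
  then obtain p a q y where w: "alternating s t k = p @ a # q" "free_walk q u" "y \<in> X"
    "rho q (u (simple_root y)) = simple_root a"
    by (rule first_loop)
  have sub: "set p \<subseteq> {s, t}" "a \<in> {s, t}" "set q \<subseteq> {s, t}" using altS unfolding w(1) by auto
  then have inS: "p \<in> lists S" "a \<in> S" "q \<in> lists S" using st by auto
  have "y = x" using loop_plane[OF st(1,2) sub(3,2) w(4)] only w(3) by blast
  define u' where "u' = rho q \<circ> u"
  have wq: "foldr step q (c, u) = (c, u')" "u' \<in> chambers"
    using walk_free[OF u inS(3) w(2)] by (auto simp: u'_def)
  have u'x: "u' (simple_root x) = simple_root a" using w(4) \<open>y = x\<close> by (simp add: u'_def)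
  have "free_walk p u'"
    unfolding free_walk_def
  proof (intro allI impI ballI notI)
    fix p1 b p2 z assume p: "p = p1 @ b # p2" and z: "z \<in> X" "rho p2 (u' (simple_root z)) = simple_root b"
    have "rho (p2 @ q) (u (simple_root z)) = simple_root b" using z by (simp add: u'_def)
    moreover have "set (p2 @ q) \<subseteq> {s, t}" "b \<in> {s, t}" using sub p by auto
    ultimately have "u (simple_root z) \<in> plane s t" using loop_plane st(1,2) by blast
    then have "z = x" using only z(1) by blast
    have alt: "alternating s t k = p1 @ b # p2 @ a # q" using w(1) p by simp
    obtain b' where b': "{b', b} = {s, t}" "p2 = alternating b' b (length p2)"
      "a = (if even (length p2) then b' else b)"
      using alternating_two_split[OF alt] .
    have bS: "b' \<in> S" "b \<in> S" "b' \<noteq> b" "m b' b = enat k"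
      using b'(1) st m_sym[of s t] by (auto simp: doubleton_eq_iff)
    have "simple_root b = rho (alternating b' b (length p2)) (simple_root (if even (length p2) then b' else b))"
      using z(2) \<open>z = x\<close> u'x b' by metis
    then have "simple_root b b' = cheb (- 2 * gram b' b) (Suc (length p2))"
      using bS(3) unfolding rho_alternating[OF bS(1-3)]
      by (simp add: comb_def simple_root_def del: cheb.simps)
    moreover have "0 < cheb (- 2 * gram b' b) (Suc (length p2))"
      using cheb_pos[OF bS(1-3), of "Suc (length p2)"] bS(4) arg_cong[OF alt, of length] by simp
    ultimately show False using bS(3) by (simp add: simple_root_def del: cheb.simps)
  qed
  then have "foldr step p (g x c, u') = (g x c, rho p \<circ> u')"
    using walk_free(1)[OF wq(2) inS(1)] by blast
  then have "foldr step (alternating s t k) (c, u) = (g x c, rho p \<circ> u')"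
    unfolding w(1) using wq step_loop[OF wq(2) x(1) u'x] by simp
  moreover have "rho (alternating s t k) \<circ> u \<circ> reflect x = rho p \<circ> u'"
  proof -
    have "rho (alternating s t k) \<circ> u \<circ> reflect x = rho p \<circ> (reflect a \<circ> (u' \<circ> reflect x))"
      unfolding w(1) u'_def by (simp add: fun_eq_iff)
    also have "u' \<circ> reflect x = reflect a \<circ> u'"
      using reflect_conj[OF wq(2) _ inS(2) u'x] x X_subset by auto
    also have "reflect a \<circ> (reflect a \<circ> u') = u'" using inS(2) by (simp add: fun_eq_iff)
    finally show ?thesis .
  qed
  ultimately show ?thesis by simp
qed

text \<open>
  The three cases are that the plane of \<open>s\<close> and \<open>t\<close> contains the images of no, of exactly one, or of at
  least two simple roots of \<open>X\<close>. They correspond to the rank of the intersection of a conjugate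
  of the dihedral group with the parabolic subgroup.
\<close>

lemma braid_step:
  assumes st: "s \<in> S" "t \<in> S" "s \<noteq> t" "m s t = enat k"
  shows "foldr step (alternating s t k) = foldr step (alternating t s k)"
proof -
  have ts: "m t s = enat k" using st m_sym by metis
  note ts = st(2,1) st(3)[symmetric] ts
  have "foldr step (alternating s t k) (c, u) = foldr step (alternating t s k) (c, u)" for c u
  proof (cases "u \<in> chambers")
    case False
    then have "foldr step w (c, u) = (c, u)" for w by (induction w) (auto simp: step_outside)
    then show ?thesis by simp
  next
    case u: True
    show ?thesis
    proof (cases "\<exists>x\<in>X. u (simple_root x) \<in> plane s t")
      case False
      have "free_walk w u" if "set w \<subseteq> {s, t}" for w
        unfolding free_walk_def using False loop_plane[OF st(1,2)] that by fastforce
      then have "free_walk (alternating s t k) u" "free_walk (alternating t s k) u"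
        using set_alternating[of s t k] set_alternating[of t s k] by auto
      moreover have "alternating s t k \<in> lists S" "alternating t s k \<in> lists S"
        using set_alternating[of s t k] set_alternating[of t s k] st by auto
      ultimately show ?thesis using walk_free(1)[OF u] braid_rho[OF st] by simp
    next
      case True
      then obtain x where x: "x \<in> X" "u (simple_root x) \<in> plane s t" by blast
      show ?thesis
      proof (cases "\<exists>y\<in>X. y \<noteq> x \<and> u (simple_root y) \<in> plane s t")
        case True
        then obtain y where "y \<in> X" "y \<noteq> x" "u (simple_root y) \<in> plane s t" by blast
        with two_in_plane[OF u st(1-3) x(1) _ _ x(2)] show ?thesis
          using braid_step_two[OF u st] braid_step_two[OF u ts] x(1) by metis
      next
        case False
        then have only: "\<And>y. y \<in> X \<Longrightarrow> u (simple_root y) \<in> plane s t \<Longrightarrow> y = x" by blast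
        show ?thesis
          using braid_step_one[OF u st x only]
            braid_step_one[OF u ts, of x, unfolded plane_sym[of t s], OF x only]
          by (simp only: braid_rho[OF st])
      qed
    qed
  qed
  then show ?thesis by auto
qed

lemma id_chambers: "id \<in> chambers"
  unfolding chambers_def using nonneg_simple_root by (auto intro!: bexI[of _ "[]"])

text \<open>
  On the coset of the identity every letter of \<open>X\<close> stays in place and acts by itself.
\<close>

lemma act_step_base:
  assumes "w \<in> gwords X"
  shows "act step w (c, id) = (act g w c, id)"
  using assms
proof (induction w arbitrary: c)
  case (Cons z w)
  obtain a e where z: "z = (a, e)" by force
  have a: "a \<in> X" using Cons.hyps z by auto
  have st: "step a (c, id) = (g a c, id)" for c
    using step_loop[OF id_chambers a] by simp
  have "step a (inv_into UNIV (g a) c, id) = (c, id)" for c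
    using bij_g[OF a] by (simp add: st bij_is_surj surj_f_inv_f)
  then have "inv_into UNIV (step a) (c, id) = (inv_into UNIV (g a) c, id)" for c
    using bij_step a X_subset by (metis bij_inv_eq_iff subsetD)
  then show ?case using Cons.IH[of c] st by (cases e) (simp_all only: z act_Cons if_True if_False)
qed simp

end

text \<open>
  Van der Lek's theorem, by extending the regular action of the smaller group.
\<close>

theorem artin_parabolic_embedding:
  assumes "coxeter_graph S m" "X \<subseteq> S" "v \<in> gwords X" "w \<in> gwords X"
    and eq: "word_eq S (artin_relations S m) v w"
  shows "word_eq X (artin_relations X m) v w"
proof -
  define R where "R = artin_relations X m"
  define g where "g = regular X R"
  interpret parabolic S m X g
  proof unfold_locales
    show "coxeter_graph S m" "X \<subseteq> S" by fact+
    show "bij (g x)" if "x \<in> X" for x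
      using bij_regular that by (simp add: g_def)
    fix x y k assume xy: "x \<in> X" "y \<in> X" "x \<noteq> y" "m x y = enat k"
    let ?r = "alternating (x, True) (y, True) k" and ?r' = "alternating (y, True) (x, True) k"
    have mem: "?r \<in> gwords X" "?r' \<in> gwords X"
      using set_alternating[of "(x, True)" "(y, True)" k] set_alternating[of "(y, True)" "(x, True)" k] xy
      by (auto simp: in_lists_conv_set)
    have "(?r, ?r') \<in> R" using xy unfolding R_def artin_relations_def by blast
    from word_eq.relation[OF _ _ mem this, of "[]" "[]"] have "word_eq X R ?r ?r'" by simp
    then have "act g ?r = act g ?r'" unfolding g_def by (rule act_regular_cong)
    then show "foldr g (alternating x y k) = foldr g (alternating y x k)"
      by (simp add: act_positive flip: map_alternating[of "\<lambda>a. (a, True)"])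
  qed
  have rel: "act step r = act step r'" if rr': "(r, r') \<in> artin_relations S m" for r r'
  proof -
    obtain s t k where "r = alternating (s, True) (t, True) k" "r' = alternating (t, True) (s, True) k"
      and st: "s \<in> S" "t \<in> S" "s \<noteq> t" "m s t = enat k"
      using rr' unfolding artin_relations_def by blast
    then have "r = map (\<lambda>a. (a, True)) (alternating s t k)"
      "r' = map (\<lambda>a. (a, True)) (alternating t s k)"
      by (simp_all add: map_alternating)
    with st show ?thesis using braid_step[OF st] by (simp only: act_positive)
  qed
  let ?e = "word_rel X R `` {[]}"
  have "act step v (?e, id) = act step w (?e, id)"
    using word_eq_act[OF eq bij_step rel] by simp
  then have "act g v ?e = act g w ?e"
    using act_step_base assms(3,4) by simp
  then have "word_rel X R `` {v} = word_rel X R `` {w}"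
    using act_regular_one assms(3,4) unfolding g_def by metis
  then show ?thesis
    using class_eq_iff assms(3,4) unfolding R_def by blast
qed

section \<open>Amalgamated products\<close>

text \<open>
  Two groups, indexed by \<open>bool\<close>, with a common subgroup \<open>K\<close>. The amalgamated product itself is not
  constructed; its place is taken by the set of normal forms, on which both groups act so that the actions
  of \<open>K\<close> agree.
\<close>

locale amalgam =
  fixes G :: "bool \<Rightarrow> 'g monoid" and K :: "'k monoid" and \<iota> :: "bool \<Rightarrow> 'k \<Rightarrow> 'g"
  assumes group_G: "group (G i)" and group_K: "group K"
    and hom_\<iota>: "\<iota> i \<in> hom K (G i)" and inj_\<iota>: "inj_on (\<iota> i) (carrier K)"
begin

text \<open>
  A representative of the right coset of the subgroup that contains \<open>y\<close>, with \<open>\<one>\<close> chosen for the subgroup itself.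
  The set of all \<open>z\<close> in the description depends on the coset only, and so does the choice.
\<close>

definition rep :: "bool \<Rightarrow> 'g \<Rightarrow> 'g" where
  "rep i y = (if y \<in> \<iota> i ` carrier K then \<one>\<^bsub>G i\<^esub>
     else SOME z. \<exists>k\<in>carrier K. z = \<iota> i k \<otimes>\<^bsub>G i\<^esub> y)"

definition coef :: "bool \<Rightarrow> 'g \<Rightarrow> 'k" where
  "coef i y = (SOME k. k \<in> carrier K \<and> \<iota> i k \<otimes>\<^bsub>G i\<^esub> rep i y = y)"

lemma \<iota>_closed: "k \<in> carrier K \<Longrightarrow> \<iota> i k \<in> carrier (G i)"
  using hom_\<iota> by (auto simp: hom_def)

lemma \<iota>_mult: "k \<in> carrier K \<Longrightarrow> k' \<in> carrier K \<Longrightarrow> \<iota> i (k \<otimes>\<^bsub>K\<^esub> k') = \<iota> i k \<otimes>\<^bsub>G i\<^esub> \<iota> i k'"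
  using hom_\<iota> by (auto simp: hom_def)

lemma \<iota>_one: "\<iota> i \<one>\<^bsub>K\<^esub> = \<one>\<^bsub>G i\<^esub>"
  using hom_one[OF hom_\<iota> group_K group_G] .

lemma \<iota>_inv: "k \<in> carrier K \<Longrightarrow> \<iota> i (inv\<^bsub>K\<^esub> k) = inv\<^bsub>G i\<^esub> (\<iota> i k)"
  using group_hom.hom_inv[of K "G i" "\<iota> i" k] group_G group_K hom_\<iota>
  by (simp add: group_hom_def group_hom_axioms_def)

lemma \<iota>_mult_in_image_iff:
  assumes "k \<in> carrier K" "y \<in> carrier (G i)"
  shows "\<iota> i k \<otimes>\<^bsub>G i\<^esub> y \<in> \<iota> i ` carrier K \<longleftrightarrow> y \<in> \<iota> i ` carrier K"
proof
  interpret Gi: group "G i" by (rule group_G)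
  interpret K: group K by (rule group_K)
  {
    assume "\<iota> i k \<otimes>\<^bsub>G i\<^esub> y \<in> \<iota> i ` carrier K"
    then obtain k' where k': "k' \<in> carrier K" "\<iota> i k \<otimes>\<^bsub>G i\<^esub> y = \<iota> i k'" by blast
    have "y = \<iota> i (inv\<^bsub>K\<^esub> k \<otimes>\<^bsub>K\<^esub> k')"
      using k' assms by (simp add: \<iota>_mult \<iota>_inv \<iota>_closed flip: k'(2) Gi.m_assoc)
    then show "y \<in> \<iota> i ` carrier K" using k' assms by blast
  next
    assume "y \<in> \<iota> i ` carrier K"
    then obtain k' where "k' \<in> carrier K" "y = \<iota> i k'" by blast
    then show "\<iota> i k \<otimes>\<^bsub>G i\<^esub> y \<in> \<iota> i ` carrier K"
      using assms by (metis K.m_closed \<iota>_mult image_eqI)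
  }
qed

lemma mult_\<iota>_in_image_iff:
  assumes "k \<in> carrier K" "y \<in> carrier (G i)"
  shows "y \<otimes>\<^bsub>G i\<^esub> \<iota> i k \<in> \<iota> i ` carrier K \<longleftrightarrow> y \<in> \<iota> i ` carrier K"
proof
  interpret Gi: group "G i" by (rule group_G)
  interpret K: group K by (rule group_K)
  {
    assume "y \<otimes>\<^bsub>G i\<^esub> \<iota> i k \<in> \<iota> i ` carrier K"
    then obtain k' where k': "k' \<in> carrier K" "y \<otimes>\<^bsub>G i\<^esub> \<iota> i k = \<iota> i k'" by blast
    have "y = \<iota> i (k' \<otimes>\<^bsub>K\<^esub> inv\<^bsub>K\<^esub> k)"
      using k' assms by (simp add: \<iota>_mult \<iota>_inv \<iota>_closed Gi.m_assoc flip: k'(2))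
    then show "y \<in> \<iota> i ` carrier K" using k' assms by blast
  next
    assume "y \<in> \<iota> i ` carrier K"
    then obtain k' where "k' \<in> carrier K" "y = \<iota> i k'" by blast
    then show "y \<otimes>\<^bsub>G i\<^esub> \<iota> i k \<in> \<iota> i ` carrier K"
      using assms by (metis K.m_closed \<iota>_mult image_eqI)
  }
qed

lemma rep_coset:
  assumes "y \<in> carrier (G i)"
  shows "\<exists>k\<in>carrier K. rep i y = \<iota> i k \<otimes>\<^bsub>G i\<^esub> y"
proof -
  interpret Gi: group "G i" by (rule group_G)
  interpret K: group K by (rule group_K)
  show ?thesis
  proof (cases "y \<in> \<iota> i ` carrier K")
    case True
    then obtain k where "k \<in> carrier K" "y = \<iota> i k" by blast
    then have "rep i y = \<iota> i (inv\<^bsub>K\<^esub> k) \<otimes>\<^bsub>G i\<^esub> y" "inv\<^bsub>K\<^esub> k \<in> carrier K"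
      using True by (simp_all add: rep_def \<iota>_inv \<iota>_closed)
    then show ?thesis by blast
  next
    case False
    have "y = \<iota> i \<one>\<^bsub>K\<^esub> \<otimes>\<^bsub>G i\<^esub> y" using assms by (simp add: \<iota>_one)
    then have "\<exists>z. \<exists>k\<in>carrier K. z = \<iota> i k \<otimes>\<^bsub>G i\<^esub> y" by blast
    from someI_ex[OF this] show ?thesis using False by (simp add: rep_def)
  qed
qed

lemma rep_closed: "y \<in> carrier (G i) \<Longrightarrow> rep i y \<in> carrier (G i)"
  using rep_coset[of y i] \<iota>_closed group.is_monoid[OF group_G[of i]] monoid.m_closed by metis

lemma coef_rep:
  assumes "y \<in> carrier (G i)"
  shows "coef i y \<in> carrier K" "\<iota> i (coef i y) \<otimes>\<^bsub>G i\<^esub> rep i y = y"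
proof -
  interpret Gi: group "G i" by (rule group_G)
  interpret K: group K by (rule group_K)
  obtain k where k: "k \<in> carrier K" "rep i y = \<iota> i k \<otimes>\<^bsub>G i\<^esub> y" using rep_coset assms by blast
  have "inv\<^bsub>K\<^esub> k \<in> carrier K \<and> \<iota> i (inv\<^bsub>K\<^esub> k) \<otimes>\<^bsub>G i\<^esub> rep i y = y"
    using k assms by (simp add: \<iota>_inv \<iota>_closed flip: Gi.m_assoc)
  then have "coef i y \<in> carrier K \<and> \<iota> i (coef i y) \<otimes>\<^bsub>G i\<^esub> rep i y = y"
    unfolding coef_def by (rule someI)
  then show "coef i y \<in> carrier K" "\<iota> i (coef i y) \<otimes>\<^bsub>G i\<^esub> rep i y = y" by auto
qed

lemma coef_unique:
  assumes "y \<in> carrier (G i)" "k \<in> carrier K" "\<iota> i k \<otimes>\<^bsub>G i\<^esub> rep i y = y"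
  shows "coef i y = k"
proof -
  interpret Gi: group "G i" by (rule group_G)
  have "\<iota> i (coef i y) = \<iota> i k"
    using assms coef_rep[OF assms(1)] rep_closed[OF assms(1)] \<iota>_closed Gi.right_cancel by metis
  then show ?thesis using inj_\<iota> assms(2) coef_rep(1)[OF assms(1)] by (metis inj_onD)
qed

lemma rep_\<iota>_mult:
  assumes "k \<in> carrier K" "y \<in> carrier (G i)"
  shows "rep i (\<iota> i k \<otimes>\<^bsub>G i\<^esub> y) = rep i y"
proof -
  interpret Gi: group "G i" by (rule group_G)
  interpret K: group K by (rule group_K)
  have "(\<exists>k'\<in>carrier K. z = \<iota> i k' \<otimes>\<^bsub>G i\<^esub> (\<iota> i k \<otimes>\<^bsub>G i\<^esub> y)) \<longleftrightarrow> (\<exists>k'\<in>carrier K. z = \<iota> i k' \<otimes>\<^bsub>G i\<^esub> y)" for z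
  proof
    assume "\<exists>k'\<in>carrier K. z = \<iota> i k' \<otimes>\<^bsub>G i\<^esub> (\<iota> i k \<otimes>\<^bsub>G i\<^esub> y)"
    then obtain k' where "k' \<in> carrier K" "z = \<iota> i (k' \<otimes>\<^bsub>K\<^esub> k) \<otimes>\<^bsub>G i\<^esub> y"
      using assms by (auto simp: \<iota>_mult \<iota>_closed Gi.m_assoc)
    then show "\<exists>k'\<in>carrier K. z = \<iota> i k' \<otimes>\<^bsub>G i\<^esub> y" using assms K.m_closed by blast
  next
    assume "\<exists>k'\<in>carrier K. z = \<iota> i k' \<otimes>\<^bsub>G i\<^esub> y"
    then obtain k' where k': "k' \<in> carrier K" "z = \<iota> i k' \<otimes>\<^bsub>G i\<^esub> y" by blast
    have "z = \<iota> i (k' \<otimes>\<^bsub>K\<^esub> inv\<^bsub>K\<^esub> k) \<otimes>\<^bsub>G i\<^esub> (\<iota> i k \<otimes>\<^bsub>G i\<^esub> y)"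
      using k' assms by (simp add: \<iota>_closed flip: Gi.m_assoc \<iota>_mult) (simp add: K.m_assoc)
    then show "\<exists>k'\<in>carrier K. z = \<iota> i k' \<otimes>\<^bsub>G i\<^esub> (\<iota> i k \<otimes>\<^bsub>G i\<^esub> y)"
      using k' assms by (intro bexI[of _ "k' \<otimes>\<^bsub>K\<^esub> inv\<^bsub>K\<^esub> k"]) auto
  qed
  then show ?thesis
    unfolding rep_def using \<iota>_mult_in_image_iff[OF assms] by simp
qed

lemma coef_\<iota>_mult:
  assumes "k \<in> carrier K" "y \<in> carrier (G i)"
  shows "coef i (\<iota> i k \<otimes>\<^bsub>G i\<^esub> y) = k \<otimes>\<^bsub>K\<^esub> coef i y"
proof (rule coef_unique)
  interpret Gi: group "G i" by (rule group_G)
  interpret K: group K by (rule group_K)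
  show "\<iota> i k \<otimes>\<^bsub>G i\<^esub> y \<in> carrier (G i)" "k \<otimes>\<^bsub>K\<^esub> coef i y \<in> carrier K"
    using assms coef_rep by (simp_all add: \<iota>_closed)
  show "\<iota> i (k \<otimes>\<^bsub>K\<^esub> coef i y) \<otimes>\<^bsub>G i\<^esub> rep i (\<iota> i k \<otimes>\<^bsub>G i\<^esub> y) = \<iota> i k \<otimes>\<^bsub>G i\<^esub> y"
    using assms coef_rep[OF assms(2)]
    by (simp add: rep_\<iota>_mult \<iota>_mult \<iota>_closed rep_closed Gi.m_assoc)
qed

lemma rep_eq_one_iff:
  assumes "y \<in> carrier (G i)"
  shows "rep i y = \<one>\<^bsub>G i\<^esub> \<longleftrightarrow> y \<in> \<iota> i ` carrier K"
proof
  interpret Gi: group "G i" by (rule group_G)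
  assume "rep i y = \<one>\<^bsub>G i\<^esub>"
  then have "y = \<iota> i (coef i y)" using coef_rep[OF assms] by (simp add: \<iota>_closed)
  then show "y \<in> \<iota> i ` carrier K" using coef_rep[OF assms] by blast
qed (simp add: rep_def)

lemma rep_rep:
  assumes "y \<in> carrier (G i)"
  shows "rep i (rep i y) = rep i y" "coef i (rep i y) = \<one>\<^bsub>K\<^esub>"
proof -
  interpret Gi: group "G i" by (rule group_G)
  interpret K: group K by (rule group_K)
  show *: "rep i (rep i y) = rep i y"
    using rep_coset[OF assms] rep_\<iota>_mult[OF _ assms] by metis
  show "coef i (rep i y) = \<one>\<^bsub>K\<^esub>"
    using rep_closed[OF assms] by (intro coef_unique) (simp_all add: * \<iota>_one)
qed

text \<open>
  The state \<open>(k, [(i\<^sub>1, t\<^sub>1), (i\<^sub>2, t\<^sub>2), \<dots>])\<close> stands for the product \<open>k t\<^sub>1 t\<^sub>2 \<dots>\<close> of an element of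
  the common subgroup and nontrivial coset representatives taken alternately from the two groups.
\<close>

definition starts :: "bool \<Rightarrow> (bool \<times> 'g) list \<Rightarrow> bool" where
  "starts i l \<longleftrightarrow> l \<noteq> [] \<and> fst (hd l) = i"

fun normal :: "(bool \<times> 'g) list \<Rightarrow> bool" where
  "normal [] \<longleftrightarrow> True"
| "normal ((i, t) # l) \<longleftrightarrow> t \<in> carrier (G i) \<and> t \<notin> \<iota> i ` carrier K \<and> rep i t = t
     \<and> \<not> starts i l \<and> normal l"

definition states :: "('k \<times> (bool \<times> 'g) list) set" where
  "states = {(k, l). k \<in> carrier K \<and> normal l}"

text \<open>
  Seen from the group \<open>i\<close>, a state is an element of this group followed by a list that does not
  start in it. This gives bijections \<open>absorb\<close> and \<open>emit\<close> between the states and the \<open>i\<close>-th \<open>views\<close>, where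
  the group can act by multiplication on the first component.
\<close>

definition absorb :: "bool \<Rightarrow> 'k \<times> (bool \<times> 'g) list \<Rightarrow> 'g \<times> (bool \<times> 'g) list" where
  "absorb i = (\<lambda>(k, l). if starts i l then (\<iota> i k \<otimes>\<^bsub>G i\<^esub> snd (hd l), tl l) else (\<iota> i k, l))"

definition emit :: "bool \<Rightarrow> 'g \<times> (bool \<times> 'g) list \<Rightarrow> 'k \<times> (bool \<times> 'g) list" where
  "emit i = (\<lambda>(y, l). (coef i y, if y \<in> \<iota> i ` carrier K then l else (i, rep i y) # l))"

definition views :: "bool \<Rightarrow> ('g \<times> (bool \<times> 'g) list) set" where
  "views i = {(y, l). y \<in> carrier (G i) \<and> normal l \<and> \<not> starts i l}"

lemma absorb_views: "z \<in> states \<Longrightarrow> absorb i z \<in> views i"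
proof -
  assume z: "z \<in> states"
  interpret Gi: group "G i" by (rule group_G)
  obtain k l where kl: "z = (k, l)" by force
  show ?thesis
    using z unfolding kl
    by (cases l) (auto simp: states_def absorb_def views_def starts_def \<iota>_closed
        intro!: monoid.m_closed group.is_monoid group_G)
qed

lemma emit_states:
  assumes "z \<in> views i"
  shows "emit i z \<in> states"
proof -
  obtain y l where yl: "z = (y, l)" by force
  have y: "y \<in> carrier (G i)" using assms yl by (auto simp: views_def)
  have "rep i y \<notin> \<iota> i ` carrier K" if "y \<notin> \<iota> i ` carrier K"
    using that rep_coset[OF y] \<iota>_mult_in_image_iff[OF _ y] by metis
  then show ?thesis
    using assms y unfolding yl
    by (auto simp: views_def emit_def states_def coef_rep rep_closed rep_rep)
qed

lemma absorb_emit: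
  assumes "z \<in> views i"
  shows "absorb i (emit i z) = z"
proof -
  interpret Gi: group "G i" by (rule group_G)
  obtain y l where yl: "z = (y, l)" by force
  have y: "y \<in> carrier (G i)" "\<not> starts i l" using assms yl by (auto simp: views_def)
  show ?thesis
  proof (cases "y \<in> \<iota> i ` carrier K")
    case True
    then have "\<iota> i (coef i y) = y"
      using coef_rep[OF y(1)] rep_eq_one_iff[OF y(1)] by (simp add: \<iota>_closed)
    then show ?thesis using True y by (simp add: yl emit_def absorb_def)
  next
    case False
    then show ?thesis using coef_rep[OF y(1)] by (simp add: yl emit_def absorb_def starts_def)
  qed
qed

lemma emit_\<iota>:
  assumes "k \<in> carrier K"
  shows "emit i (\<iota> i k, l) = (k, l)"
proof -
  interpret Gi: group "G i" by (rule group_G)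
  have "coef i (\<iota> i k) = k"
    using assms rep_eq_one_iff[of "\<iota> i k" i] by (intro coef_unique) (auto simp: \<iota>_closed)
  then show ?thesis using assms by (simp add: emit_def)
qed

lemma emit_absorb:
  assumes "z \<in> states"
  shows "emit i (absorb i z) = z"
proof -
  interpret Gi: group "G i" by (rule group_G)
  interpret K: group K by (rule group_K)
  obtain k l where kl: "z = (k, l)" by force
  have k: "k \<in> carrier K" and l: "normal l" using assms kl by (auto simp: states_def)
  show ?thesis
  proof (cases "starts i l")
    case True
    then obtain t l' where lt: "l = (i, t) # l'" unfolding starts_def by (cases l) auto
    then have t: "t \<in> carrier (G i)" "t \<notin> \<iota> i ` carrier K" "rep i t = t" using l by auto
    have "coef i t = \<one>\<^bsub>K\<^esub>" using rep_rep(2)[OF t(1)] t(3) by simp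
    then show ?thesis
      using k t by (simp add: kl lt absorb_def starts_def emit_def coef_\<iota>_mult rep_\<iota>_mult
          \<iota>_mult_in_image_iff)
  next
    case False
    then show ?thesis using emit_\<iota>[OF k] by (simp add: kl absorb_def)
  qed
qed

definition gact :: "bool \<Rightarrow> 'g \<Rightarrow> 'k \<times> (bool \<times> 'g) list \<Rightarrow> 'k \<times> (bool \<times> 'g) list" where
  "gact i x z = (if z \<in> states then emit i (apfst ((\<otimes>\<^bsub>G i\<^esub>) x) (absorb i z)) else z)"

lemma views_mult:
  assumes "x \<in> carrier (G i)" "v \<in> views i"
  shows "apfst ((\<otimes>\<^bsub>G i\<^esub>) x) v \<in> views i"
proof -
  interpret Gi: group "G i" by (rule group_G)
  show ?thesis using assms by (auto simp: views_def)
qed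

lemma gact_states: "x \<in> carrier (G i) \<Longrightarrow> z \<in> states \<Longrightarrow> gact i x z \<in> states"
  by (simp add: gact_def emit_states views_mult absorb_views)

lemma gact_mult:
  assumes "x \<in> carrier (G i)" "y \<in> carrier (G i)"
  shows "gact i x (gact i y z) = gact i (x \<otimes>\<^bsub>G i\<^esub> y) z"
proof (cases "z \<in> states")
  interpret Gi: group "G i" by (rule group_G)
  case True
  note v = absorb_views[OF True, of i]
  have "apfst ((\<otimes>\<^bsub>G i\<^esub>) x) (apfst ((\<otimes>\<^bsub>G i\<^esub>) y) (absorb i z)) = apfst ((\<otimes>\<^bsub>G i\<^esub>) (x \<otimes>\<^bsub>G i\<^esub> y)) (absorb i z)"
    using assms v by (auto simp: views_def Gi.m_assoc)
  then show ?thesis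
    using True gact_states[OF assms(2) True] absorb_emit[OF views_mult[OF assms(2) v]]
    by (simp add: gact_def)
qed (simp add: gact_def)

lemma gact_one: "gact i \<one>\<^bsub>G i\<^esub> z = z"
proof (cases "z \<in> states")
  interpret Gi: group "G i" by (rule group_G)
  case True
  have "apfst ((\<otimes>\<^bsub>G i\<^esub>) \<one>\<^bsub>G i\<^esub>) (absorb i z) = absorb i z"
    using absorb_views[OF True, of i] by (auto simp: views_def)
  then show ?thesis using True emit_absorb by (simp add: gact_def)
qed (simp add: gact_def)

lemma gact_inverse:
  assumes "x \<in> carrier (G i)"
  shows "bij (gact i x)" "inv_into UNIV (gact i x) = gact i (inv\<^bsub>G i\<^esub> x)"
proof -
  interpret Gi: group "G i" by (rule group_G)
  have "gact i x \<circ> gact i (inv\<^bsub>G i\<^esub> x) = id" "gact i (inv\<^bsub>G i\<^esub> x) \<circ> gact i x = id"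
    using assms by (auto simp: gact_mult gact_one)
  then show "bij (gact i x)" "inv_into UNIV (gact i x) = gact i (inv\<^bsub>G i\<^esub> x)"
    by (auto intro: o_bij inv_unique_comp)
qed

lemma gact_\<iota>:
  assumes "k \<in> carrier K"
  shows "gact i (\<iota> i k) z = (if z \<in> states then apfst ((\<otimes>\<^bsub>K\<^esub>) k) z else z)"
proof (cases "z \<in> states")
  interpret Gi: group "G i" by (rule group_G)
  interpret K: group K by (rule group_K)
  case True
  obtain k' l where z: "z = (k', l)" by force
  have k': "k' \<in> carrier K" and l: "normal l" using True z by (auto simp: states_def)
  have "apfst ((\<otimes>\<^bsub>G i\<^esub>) (\<iota> i k)) (absorb i z) = absorb i (k \<otimes>\<^bsub>K\<^esub> k', l)"
    using assms k' l unfolding z absorb_def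
    by (cases l) (auto simp: starts_def \<iota>_mult \<iota>_closed
        intro!: monoid.m_assoc[symmetric] group.is_monoid group_G)
  moreover have "(k \<otimes>\<^bsub>K\<^esub> k', l) \<in> states" using assms k' l by (simp add: states_def)
  ultimately show ?thesis using True emit_absorb by (simp add: gact_def z)
qed (simp add: gact_def)

lemma base_state: "(\<one>\<^bsub>K\<^esub>, []) \<in> states"
  using group.is_monoid[OF group_K] by (simp add: states_def monoid.one_closed)

lemma gact_base_inj:
  assumes "x \<in> carrier (G i)" "y \<in> carrier (G i)" "gact i x (\<one>\<^bsub>K\<^esub>, []) = gact i y (\<one>\<^bsub>K\<^esub>, [])"
  shows "x = y"
proof -
  interpret Gi: group "G i" by (rule group_G)
  have "absorb i (gact i z (\<one>\<^bsub>K\<^esub>, [])) = (z, [])" if z: "z \<in> carrier (G i)" for z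
    using that base_state absorb_emit[of "(z, [])" i]
    by (simp add: gact_def absorb_def starts_def \<iota>_one views_def)
  then show ?thesis using assms by (metis Pair_inject)
qed

text \<open>
  Multiplication by an element outside the common subgroup, taken from the group in which the normal form
  does not start, makes the normal form longer.
\<close>

lemma gact_prepends:
  assumes "x \<in> carrier (G i)" "x \<notin> \<iota> i ` carrier K" "(k, l) \<in> states" "\<not> starts i l"
  obtains k' t where "gact i x (k, l) = (k', (i, t) # l)"
proof -
  have "k \<in> carrier K" using assms by (simp add: states_def)
  then have "x \<otimes>\<^bsub>G i\<^esub> \<iota> i k \<notin> \<iota> i ` carrier K" using assms mult_\<iota>_in_image_iff by blast
  then show ?thesis using that assms by (simp add: gact_def absorb_def emit_def)
qed

lemma reduced_sequence:
  assumes "\<And>i x. (i, x) \<in> set xs \<Longrightarrow> x \<in> carrier (G i) \<and> x \<notin> \<iota> i ` carrier K"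
    and "distinct_adj (map fst xs)"
  shows "\<exists>k l. foldr (\<lambda>(i, x). gact i x) xs (\<one>\<^bsub>K\<^esub>, []) = (k, l) \<and> (k, l) \<in> states
           \<and> map fst l = map fst xs"
  using assms
proof (induction xs)
  case Nil
  then show ?case using base_state by simp
next
  case (Cons z xs)
  obtain i x where z: "z = (i, x)" by force
  have "distinct_adj (map fst xs)" using Cons.prems(2) by (cases xs) auto
  then obtain k l where kl: "foldr (\<lambda>(i, x). gact i x) xs (\<one>\<^bsub>K\<^esub>, []) = (k, l)" "(k, l) \<in> states"
    "map fst l = map fst xs"
    using Cons.IH Cons.prems(1) by auto
  have x: "x \<in> carrier (G i)" "x \<notin> \<iota> i ` carrier K" using Cons.prems(1) z by auto
  have "\<not> starts i l"
    using Cons.prems(2) z kl(3) by (cases xs; cases l) (auto simp: starts_def)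
  then obtain k' t where "gact i x (k, l) = (k', (i, t) # l)" using gact_prepends x kl(2) by blast
  then show ?case using gact_states[OF x(1) kl(2)] kl z by simp
qed

end

subsection \<open>Amalgams of presented groups\<close>

text \<open>
  Two presentations, together with a presentation of the common subgroup on the shared generators. By \<open>embed\<close> the
  common subgroup embeds into both groups.
\<close>

locale presented_amalgam =
  fixes X :: "bool \<Rightarrow> 'a set" and R :: "bool \<Rightarrow> ('a gword \<times> 'a gword) set"
    and Q :: "('a gword \<times> 'a gword) set"
  assumes R_words: "(r, r') \<in> R i \<Longrightarrow> r \<in> gwords (X i) \<and> r' \<in> gwords (X i)"
    and embed: "v \<in> gwords (X True \<inter> X False) \<Longrightarrow> w \<in> gwords (X True \<inter> X False) \<Longrightarrow>
      word_eq (X i) (R i) v w \<longleftrightarrow> word_eq (X True \<inter> X False) Q v w"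
begin

abbreviation C :: "'a set" where "C \<equiv> X True \<inter> X False"

abbreviation total_eq :: "'a gword \<Rightarrow> 'a gword \<Rightarrow> bool" (infix \<open>\<approx>\<close> 50) where
  "v \<approx> w \<equiv> word_eq (X True \<union> X False) (R True \<union> R False) v w"

abbreviation factor :: "bool \<Rightarrow> 'a gword set monoid" where
  "factor i \<equiv> presented_group (X i) (R i)"

abbreviation cls :: "bool \<Rightarrow> 'a gword \<Rightarrow> 'a gword set" where
  "cls i w \<equiv> word_rel (X i) (R i) `` {w}"

abbreviation core :: "'a gword set monoid" where
  "core \<equiv> presented_group C Q"

text \<open>
  The image of a class is the union of the classes of its elements, which is a single class.
\<close>

definition incl :: "bool \<Rightarrow> 'a gword set \<Rightarrow> 'a gword set" where
  "incl i c = word_rel (X i) (R i) `` c"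

lemma C_gwords: "w \<in> gwords C \<Longrightarrow> w \<in> gwords (X i)"
  by (cases i) auto

lemma X_gwords: "w \<in> gwords (X i) \<Longrightarrow> w \<in> gwords (X True \<union> X False)"
  by (cases i) auto

lemma factor_imp_total: "word_eq (X i) (R i) v w \<Longrightarrow> v \<approx> w"
  by (erule word_eq_mono) (cases i; auto)+

lemma incl_class:
  assumes "w \<in> gwords C"
  shows "incl i (word_rel C Q `` {w}) = cls i w"
proof -
  have "word_eq (X i) (R i) w u" if "word_eq C Q w v" "word_eq (X i) (R i) v u" for u v
    using that word_eq.trans embed assms word_eq_gwords by metis
  moreover have "word_eq C Q w w" using assms by (rule word_eq.refl)
  ultimately show ?thesis unfolding incl_def word_rel_def by blast
qed

sublocale amalgam factor core incl
proof (rule amalgam.intro)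
  fix i
  show "group (factor i)" "group core" by (rule group_presented_group, rule group_presented_group)
  show "incl i \<in> hom core (factor i)"
  proof (rule homI)
    fix c assume "c \<in> carrier core"
    then obtain v where v: "v \<in> gwords C" "c = word_rel C Q `` {v}" by (rule carrier_classE)
    then show "incl i c \<in> carrier (factor i)"
      using class_in_carrier[OF C_gwords[OF v(1)]] by (simp only: incl_class)
    fix d assume "d \<in> carrier core"
    then obtain w where w: "w \<in> gwords C" "d = word_rel C Q `` {w}" by (rule carrier_classE)
    have vw: "v @ w \<in> gwords C" using v w by auto
    show "incl i (c \<otimes>\<^bsub>core\<^esub> d) = incl i c \<otimes>\<^bsub>factor i\<^esub> incl i d"
      unfolding v(2) w(2) presented_group_mult_class[OF v(1) w(1)]
        incl_class[OF v(1)] incl_class[OF w(1)] incl_class[OF vw]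
        presented_group_mult_class[OF C_gwords[OF v(1)] C_gwords[OF w(1)]] ..
  qed
  show "inj_on (incl i) (carrier core)"
  proof (rule inj_onI)
    fix c d assume cd: "c \<in> carrier core" "d \<in> carrier core" "incl i c = incl i d"
    obtain v where v: "v \<in> gwords C" "c = word_rel C Q `` {v}" using carrier_classE[OF cd(1)] .
    obtain w where w: "w \<in> gwords C" "d = word_rel C Q `` {w}" using carrier_classE[OF cd(2)] .
    have "word_eq (X i) (R i) v w"
      using cd(3) v w C_gwords by (simp only: incl_class class_eq_iff)
    then show "c = d" using embed v w by (simp only: class_eq_iff)
  qed
qed

text \<open>
  A shared generator can act through either group, as the two actions agree on the common subgroup.
\<close>

definition letter_act :: "'a \<Rightarrow> 'a gword set \<times> (bool \<times> 'a gword set) list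
    \<Rightarrow> 'a gword set \<times> (bool \<times> 'a gword set) list" where
  "letter_act a = (let i = a \<in> X True in gact i (cls i [(a, True)]))"

lemma gact_core:
  assumes "w \<in> gwords C"
  shows "gact i (cls i w) = gact j (cls j w)"
proof -
  have "word_rel C Q `` {w} \<in> carrier core" using assms by (rule class_in_carrier)
  from gact_\<iota>[OF this, of i] gact_\<iota>[OF this, of j] show ?thesis
    unfolding incl_class[OF assms] by (intro ext) simp
qed

lemma letter_act_eq:
  assumes "a \<in> X i"
  shows "letter_act a = gact i (cls i [(a, True)])"
proof (cases "(a \<in> X True) = i")
  case True
  then show ?thesis by (simp add: letter_act_def)
next
  case False
  then have "[(a, True)] \<in> gwords C" using assms by (cases i) auto
  then show ?thesis unfolding letter_act_def Let_def by (rule gact_core)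
qed

lemma act_letter_act:
  assumes "w \<in> gwords (X i)"
  shows "act letter_act w = gact i (cls i w)"
proof
  fix z
  show "act letter_act w z = gact i (cls i w) z"
    using assms
  proof (induction w)
    case Nil
    show ?case using gact_one[of i z] by (simp add: one_class)
  next
    case (Cons x w)
    obtain a e where x: "x = (a, e)" by force
    have a: "a \<in> X i" "[(a, e)] \<in> gwords (X i)" "[(a, True)] \<in> gwords (X i)" "w \<in> gwords (X i)"
      using Cons.hyps x by auto
    have "inv_into UNIV (letter_act a) = gact i (cls i [(a, False)])"
      using gact_inverse(2)[OF class_in_carrier[OF a(3), of "R i"]] inv_class[OF a(3), of "R i"]
      by (simp add: letter_act_eq[OF a(1)] inverse_word_def)
    then have "act letter_act (x # w) z = gact i (cls i [(a, e)]) (gact i (cls i w) z)"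
      using Cons.IH by (cases e) (simp_all only: x act_Cons letter_act_eq[OF a(1)] if_True if_False)
    also have "\<dots> = gact i (cls i ([(a, e)] @ w)) z"
      using class_in_carrier[OF a(2)] class_in_carrier[OF a(4)]
      by (simp only: gact_mult presented_group_mult_class[OF a(2,4)])
    finally show ?case by (simp add: x)
  qed
qed

lemma total_eq_act:
  assumes "v \<approx> w"
  shows "act letter_act v = act letter_act w"
  using assms
proof (rule word_eq_act)
  fix a assume "a \<in> X True \<union> X False"
  then obtain i where i: "a \<in> X i" by blast
  then have "[(a, True)] \<in> gwords (X i)" by auto
  from gact_inverse(1)[OF class_in_carrier[OF this, of "R i"]] show "bij (letter_act a)"
    by (simp add: letter_act_eq[OF i])
next
  fix r r' assume "(r, r') \<in> R True \<union> R False"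
  then obtain i where i: "(r, r') \<in> R i" by blast
  note w = R_words[OF i]
  have "word_eq (X i) (R i) ([] @ r @ []) ([] @ r' @ [])"
    using w i by (intro word_eq.relation) auto
  then have "cls i r = cls i r'" using w by (simp only: class_eq_iff append_Nil append_Nil2)
  then show "act letter_act r = act letter_act r'" using act_letter_act[of r i] act_letter_act[of r' i] w by (simp only: simp_thms)
qed

lemma total_eq_imp_factor:
  assumes "v \<in> gwords (X i)" "w \<in> gwords (X i)" "v \<approx> w"
  shows "word_eq (X i) (R i) v w"
proof -
  have "gact i (cls i v) (\<one>\<^bsub>core\<^esub>, []) = gact i (cls i w) (\<one>\<^bsub>core\<^esub>, [])"
    using total_eq_act[OF assms(3)] act_letter_act[OF assms(1)] act_letter_act[OF assms(2)] by metis
  then have "cls i v = cls i w"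
    by (rule gact_base_inj[OF class_in_carrier[OF assms(1)] class_in_carrier[OF assms(2)]])
  then show ?thesis using assms(1,2) by (simp only: class_eq_iff)
qed

text \<open>
  The normal form theorem for amalgamated products: such a product takes the base state to a
  normal form with one entry for each syllable.
\<close>

lemma reduced_product_nontrivial:
  assumes words: "\<And>i x. (i, x) \<in> set xs \<Longrightarrow> x \<in> gwords (X i) \<and> (\<forall>c\<in>gwords C. \<not> x \<approx> c)"
    and alt: "distinct_adj (map fst xs)" and "xs \<noteq> []"
  shows "\<not> concat (map snd xs) \<approx> []"
proof
  assume trivial: "concat (map snd xs) \<approx> []"
  define ys where "ys = map (\<lambda>(i, x). (i, cls i x)) xs"
  have members: "y \<in> carrier (factor i) \<and> y \<notin> incl i ` carrier core" if iy: "(i, y) \<in> set ys" for i y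
  proof -
    obtain x where x: "(i, x) \<in> set xs" "y = cls i x" using iy by (auto simp: ys_def)
    have xX: "x \<in> gwords (X i)" using words x by blast
    have "y \<noteq> incl i c" if "c \<in> carrier core" for c
    proof
      assume "y = incl i c"
      obtain v where "v \<in> gwords C" "c = word_rel C Q `` {v}"
        using \<open>c \<in> carrier core\<close> by (rule carrier_classE)
      then have "cls i x = cls i v" "v \<in> gwords C" using \<open>y = incl i c\<close> x incl_class by auto
      then have "word_eq (X i) (R i) x v" using xX C_gwords by (simp only: class_eq_iff)
      then show False using words[OF x(1)] \<open>v \<in> gwords C\<close> factor_imp_total by blast
    qed
    then show ?thesis using x xX class_in_carrier by blast
  qed
  have fst_ys: "map fst ys = map fst xs" by (simp add: ys_def case_prod_beta)
  obtain k l where kl: "foldr (\<lambda>(i, y). gact i y) ys (\<one>\<^bsub>core\<^esub>, []) = (k, l)" "map fst l = map fst xs"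
    using reduced_sequence[OF members, of ys] alt unfolding fst_ys by blast
  have "act letter_act (concat (map snd xs)) z = foldr (\<lambda>(i, y). gact i y) ys z" for z
    unfolding ys_def using words
  proof (induction xs)
    case (Cons p xs)
    obtain i x where p: "p = (i, x)" by force
    have "x \<in> gwords (X i)" using Cons.prems[of i x] p by simp
    moreover have "act letter_act (concat (map snd xs)) z
        = foldr (\<lambda>(i, y). gact i y) (map (\<lambda>(i, x). (i, cls i x)) xs) z"
      using Cons.prems by (intro Cons.IH) auto
    ultimately show ?case by (simp add: p act_append act_letter_act)
  qed simp
  then have "(k, l) = (\<one>\<^bsub>core\<^esub>, [])" using kl(1) total_eq_act[OF trivial] by simp
  then show False using kl(2) \<open>xs \<noteq> []\<close> by simp
qed

end

subsection \<open>Torsion in amalgams\<close>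

lemma word_eq_power:
  assumes "word_eq X R v w"
  shows "word_eq X R (concat (replicate n v)) (concat (replicate n w))"
  by (induction n) (simp_all add: word_eq.refl word_eq_append[OF assms])

lemma word_eq_cancel_middle:
  assumes "word_eq X R m []" "u \<in> gwords X" "v \<in> gwords X"
  shows "word_eq X R (u @ m @ v) (u @ v)"
  using word_eq_context[OF assms] by simp

lemma word_eq_conj_power:
  assumes "p \<in> gwords X" "w \<in> gwords X"
  shows "word_eq X R (concat (replicate n (inverse_word p @ w @ p)))
           (inverse_word p @ concat (replicate n w) @ p)"
proof (induction n)
  case 0
  show ?case using word_eq_inverse_left[OF assms(1)] by (simp add: word_eq.sym)
next
  case (Suc n)
  let ?p = "inverse_word p" and ?W = "concat (replicate n w)"
  have W: "?W \<in> gwords X" "?p \<in> gwords X"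
    using power_gwords[OF assms(2)] inverse_word_gwords[OF assms(1)] by auto
  have "word_eq X R ((?p @ w @ p) @ concat (replicate n (?p @ w @ p))) ((?p @ w @ p) @ ?p @ ?W @ p)"
    using Suc assms W by (intro word_eq_append word_eq.refl) auto
  moreover have "word_eq X R ((?p @ w) @ (p @ ?p) @ (?W @ p)) ((?p @ w) @ (?W @ p))"
    using assms W by (intro word_eq_cancel_middle word_eq_inverse_right) auto
  ultimately show ?case using word_eq.trans by fastforce
qed

lemma word_eq_conj_trivial:
  assumes "p \<in> gwords X" "w \<in> gwords X"
  shows "word_eq X R (inverse_word p @ w @ p) [] \<longleftrightarrow> word_eq X R w []"
proof
  let ?p = "inverse_word p"
  have p: "?p \<in> gwords X" using inverse_word_gwords assms(1) .
  note right = word_eq_inverse_right[OF assms(1), of R]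
  {
    assume triv: "word_eq X R (?p @ w @ p) []"
    have "word_eq X R ([] @ (p @ ?p) @ (w @ (p @ ?p))) ([] @ (w @ (p @ ?p)))"
      using assms p by (intro word_eq_cancel_middle right) auto
    moreover have "word_eq X R (w @ (p @ ?p) @ []) (w @ [])"
      using assms p by (intro word_eq_cancel_middle right) auto
    ultimately have "word_eq X R (p @ (?p @ w @ p) @ ?p) w"
      using word_eq.trans by fastforce
    moreover have "word_eq X R (p @ (?p @ w @ p) @ ?p) (p @ ?p)"
      using assms p triv by (intro word_eq_cancel_middle)
    ultimately show "word_eq X R w []"
      using right word_eq.trans word_eq.sym by metis
  next
    assume "word_eq X R w []"
    then have "word_eq X R (?p @ w @ p) (?p @ p)"
      using assms p by (intro word_eq_cancel_middle)
    then show "word_eq X R (?p @ w @ p) []"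
      using word_eq_inverse_left[OF assms(1)] word_eq.trans by metis
  }
qed

lemma distinct_adj_power:
  assumes "distinct_adj xs" "xs \<noteq> [] \<Longrightarrow> last xs \<noteq> hd xs"
  shows "distinct_adj (concat (replicate n xs))"
proof (cases "xs = []")
  case False
  have "hd (concat (replicate n xs)) = hd xs" if "concat (replicate n xs) \<noteq> []" for n
    using that False by (cases n) auto
  then show ?thesis
    using assms False by (induction n) (auto simp: distinct_adj_append_iff)
qed (induction n; simp)

context presented_amalgam
begin

text \<open>
  A factorisation into words over one of the two generating sets, not of \<open>w\<close> itself but of a conjugate of it.
\<close>

definition syllabic :: "'a gword \<Rightarrow> 'a gword list \<Rightarrow> bool" where
  "syllabic w xs \<longleftrightarrow> (\<forall>x\<in>set xs. \<exists>i. x \<in> gwords (X i)) \<and>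
     (\<exists>p\<in>gwords (X True \<union> X False). inverse_word p @ w @ p \<approx> concat xs)"

lemma syllabic_words: "syllabic w xs \<Longrightarrow> concat xs \<in> gwords (X True \<union> X False)"
  unfolding syllabic_def using word_eq_gwords by blast

lemma syllabic_exists:
  assumes "w \<in> gwords (X True \<union> X False)"
  shows "syllabic w (map (\<lambda>x. [x]) w)"
proof -
  have "concat (map (\<lambda>x. [x]) w) = w" by (induction w) auto
  moreover have "\<exists>i. [x] \<in> gwords (X i)" if "x \<in> set w" for x
    using assms that by (cases x) (auto simp: in_lists_conv_set)
  ultimately show ?thesis
    unfolding syllabic_def using assms
    by (auto intro!: bexI[of _ "[]"] word_eq.refl simp: inverse_word_def simp del: concat_map_singleton)
qed

lemma syllabic_cong:
  assumes "syllabic w xs" "concat xs \<approx> concat ys" "\<forall>y\<in>set ys. \<exists>i. y \<in> gwords (X i)"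
  shows "syllabic w ys"
  using assms word_eq.trans unfolding syllabic_def by metis

lemma syllabic_rotate:
  assumes w: "w \<in> gwords (X True \<union> X False)" and s: "syllabic w (x # xs)"
  shows "syllabic w (xs @ [x])"
proof -
  let ?U = "X True \<union> X False"
  obtain p where p: "p \<in> gwords ?U" "inverse_word p @ w @ p \<approx> x @ concat xs"
    using s unfolding syllabic_def by auto
  have U: "x \<in> gwords ?U" "concat xs \<in> gwords ?U"
    using syllabic_words[OF s] by auto
  have "inverse_word x @ (inverse_word p @ w @ p) @ x \<approx> inverse_word x @ (x @ concat xs) @ x"
    using p(2) U by (intro word_eq_context inverse_word_gwords) auto
  moreover have "[] @ (inverse_word x @ x) @ (concat xs @ x) \<approx> [] @ (concat xs @ x)"
    using U by (intro word_eq_cancel_middle word_eq_inverse_left) auto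
  ultimately have "inverse_word (p @ x) @ w @ (p @ x) \<approx> concat (xs @ [x])"
    using word_eq.trans[of _ _ "inverse_word x @ (inverse_word p @ w @ p) @ x"
        "inverse_word x @ (x @ concat xs) @ x" "concat xs @ x"]
    by (simp add: inverse_word_def)
  moreover have "p @ x \<in> gwords ?U" using p U by auto
  moreover have "\<forall>y\<in>set (xs @ [x]). \<exists>i. y \<in> gwords (X i)"
    using s unfolding syllabic_def by auto
  ultimately show ?thesis unfolding syllabic_def by blast
qed

lemma syllabic_power:
  assumes w: "w \<in> gwords (X True \<union> X False)" and s: "syllabic w xs"
    and triv: "concat (replicate n w) \<approx> []"
  shows "concat (replicate n (concat xs)) \<approx> []"
proof -
  obtain p where p: "p \<in> gwords (X True \<union> X False)" "inverse_word p @ w @ p \<approx> concat xs"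
    using s unfolding syllabic_def by auto
  have "inverse_word p @ concat (replicate n w) @ p \<approx> []"
    using word_eq_conj_trivial[OF p(1) power_gwords[OF w]] triv by simp
  from word_eq.trans[OF word_eq.sym[OF word_eq_power[OF p(2)]]
      word_eq.trans[OF word_eq_conj_power[OF p(1) w] this]]
  show ?thesis .
qed

lemma syllabic_trivial:
  assumes w: "w \<in> gwords (X True \<union> X False)" and s: "syllabic w xs" and "concat xs \<approx> []"
  shows "w \<approx> []"
  using assms word_eq_conj_trivial[OF _ w] word_eq.trans unfolding syllabic_def by metis

text \<open>
  Two neighbours in a shortest factorisation do not lie in a common factor, as they could
  be merged.
\<close>

lemma minimal_syllables_separated:
  assumes s: "syllabic w (xs @ x # y # ys)"
    and min: "\<And>zs. syllabic w zs \<Longrightarrow> length (xs @ x # y # ys) \<le> length zs"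
    and xy: "x \<approx> x'" "y \<approx> y'" "x' \<in> gwords (X i)" "y' \<in> gwords (X i)"
  shows False
proof -
  have "concat xs @ (x @ y) @ concat ys \<approx> concat xs @ (x' @ y') @ concat ys"
    using syllabic_words[OF s] xy by (intro word_eq_context word_eq_append) auto
  moreover have "x' @ y' \<in> gwords (X i)" using xy by auto
  ultimately have "syllabic w (xs @ (x' @ y') # ys)"
    using s by (intro syllabic_cong[OF s]) (auto simp: syllabic_def)
  from min[OF this] show False by simp
qed

text \<open>
  Among all conjugates of a torsion element take a factorisation with the fewest syllables. If it has at least two,
  then no syllable lies in the common subgroup and neighbours come from different factors,
  even cyclically, because rotating the factorisation is a conjugation. So the powers are reduced
  products and hence nontrivial. With at most one syllable the element is conjugate into a factor.
\<close>

theorem torsion_free_amalgam: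
  assumes "\<And>i. torsion_free (factor i)"
  shows "torsion_free (presented_group (X True \<union> X False) (R True \<union> R False))"
  unfolding torsion_free_presented_group_iff
proof (intro ballI allI impI)
  fix w and n :: nat
  assume w: "w \<in> gwords (X True \<union> X False)" and n: "0 < n" and triv: "concat (replicate n w) \<approx> []"
  obtain xs where xs: "syllabic w xs" "\<And>zs. syllabic w zs \<Longrightarrow> length xs \<le> length zs"
    using ex_has_least_nat[of "syllabic w" _ length] syllabic_exists[OF w] by metis
  have power: "concat (replicate n (concat xs)) \<approx> []" using syllabic_power[OF w xs(1) triv] .
  consider "xs = []" | x where "xs = [x]" | "length xs \<ge> 2"
    by (cases xs; cases "tl xs") auto
  then show "w \<approx> []"
  proof cases
    case 1
    then show ?thesis using syllabic_trivial[OF w xs(1)] by (simp add: word_eq.refl)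
  next
    case (2 x)
    then obtain i where i: "x \<in> gwords (X i)" using xs(1) by (auto simp: syllabic_def)
    have "word_eq (X i) (R i) (concat (replicate n x)) []"
      using power 2 i power_gwords[OF i] by (intro total_eq_imp_factor) auto
    then have "word_eq (X i) (R i) x []"
      using assms[of i] i n unfolding torsion_free_presented_group_iff by blast
    then have "concat xs \<approx> []" using 2 factor_imp_total by simp
    then show ?thesis using syllabic_trivial[OF w xs(1)] by blast
  next
    case 3
    have U: "x \<in> gwords (X True \<union> X False)" if "x \<in> set xs" for x
      using that xs(1) X_gwords unfolding syllabic_def by blast
    have adjacent: False
      if "xs = p @ x # y # q" "x \<approx> x'" "y \<approx> y'" "x' \<in> gwords (X i)" "y' \<in> gwords (X i)" for p x y q x' y' i
      using minimal_syllables_separated[of w p x y q x' y' i] xs that by blast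
    have not_core: False if "x \<in> set xs" "c \<in> gwords C" "x \<approx> c" for x c
    proof -
      obtain p q where pq: "xs = p @ x # q" using \<open>x \<in> set xs\<close> split_list by metis
      show False
      proof (cases q)
        case (Cons y q')
        obtain i where "y \<in> gwords (X i)" using xs(1) pq Cons unfolding syllabic_def by auto
        then show False
          using adjacent[of p x y q' c y i] pq Cons that word_eq.refl[OF X_gwords] C_gwords by blast
      next
        case Nil
        then obtain p' y where p': "p = p' @ [y]" using 3 pq by (cases p rule: rev_cases) auto
        obtain i where "y \<in> gwords (X i)" using xs(1) pq p' unfolding syllabic_def by auto
        then show False
          using adjacent[of p' y x "[]" y c i] pq p' Nil that word_eq.refl[OF X_gwords] C_gwords by auto
      qed
    qed
    define idx where "idx x = (x \<in> gwords (X True))" for x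
    have idx: "x \<in> gwords (X (idx x))" if "x \<in> set xs" for x
    proof -
      obtain i where i: "x \<in> gwords (X i)"
        using \<open>x \<in> set xs\<close> xs(1) unfolding syllabic_def by blast
      show ?thesis
      proof (cases "idx x")
        case True
        then have "x \<in> gwords (X True)" unfolding idx_def .
        moreover have "idx x = True" using True by simp
        ultimately show ?thesis by (simp only:)
      next
        case False
        then have "i = False" using i unfolding idx_def by metis
        then have "idx x = i" using False by simp
        with i show ?thesis by (simp only:)
      qed
    qed
    have "distinct_adj (map idx xs)"
    proof (rule ccontr)
      assume "\<not> ?thesis"
      then obtain p a q where "map idx xs = p @ a # a # q" using not_distinct_adj_split by blast
      then obtain p' x y q' where xy: "xs = p' @ x # y # q'" "idx x = idx y"
        by (auto simp: map_eq_append_conv map_eq_Cons_conv)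
      then have "x \<in> gwords (X (idx x))" "y \<in> gwords (X (idx x))" using idx[of x] idx[of y] by auto
      then show False using adjacent[OF xy(1)] word_eq.refl[OF X_gwords] by blast
    qed
    moreover have "last (map idx xs) \<noteq> hd (map idx xs)"
    proof
      obtain x z zs where x: "xs = x # z # zs" using 3 by (cases xs; cases "tl xs") auto
      obtain ys y where "z # zs = ys @ [y]" by (cases "z # zs" rule: rev_cases) auto
      with x have y: "xs = x # ys @ [y]" by simp
      have rot: "syllabic w (ys @ y # x # [])" using syllabic_rotate[OF w, of x "ys @ [y]"] xs(1) y by simp
      assume "last (map idx xs) = hd (map idx xs)"
      then have "idx x = idx y" using y by simp
      then have "x \<in> gwords (X (idx x))" "y \<in> gwords (X (idx x))" using idx[of x] idx[of y] y by auto
      moreover have "length (ys @ y # x # []) \<le> length zs" if "syllabic w zs" for zs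
        using xs(2)[OF that] y by simp
      ultimately show False
        using minimal_syllables_separated[OF rot] word_eq.refl[OF X_gwords] by blast
    qed
    ultimately have alt: "distinct_adj (concat (replicate n (map idx xs)))"
      by (intro distinct_adj_power)
    define zs where "zs = concat (replicate n (map (\<lambda>x. (idx x, x)) xs))"
    have "map fst zs = concat (replicate n (map idx xs))"
      by (simp add: zs_def map_concat comp_def)
    moreover have "concat (map snd zs) = concat (replicate n (concat xs))"
      unfolding zs_def by (induction n) (simp_all add: comp_def)
    moreover have "zs \<noteq> []" using 3 n unfolding zs_def by (cases n; cases xs) auto
    moreover have "x \<in> gwords (X i) \<and> (\<forall>c\<in>gwords C. \<not> x \<approx> c)" if "(i, x) \<in> set zs" for i x
    proof -
      have "x \<in> set xs" "i = idx x"
        using that unfolding zs_def by (auto split: if_splits)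
      then show ?thesis using idx not_core by blast
    qed
    ultimately have "\<not> concat (replicate n (concat xs)) \<approx> []"
      using reduced_product_nontrivial[of zs] alt by metis
    then show ?thesis using power by blast
  qed
qed

end

section \<open>Torsion in Artin-Tits groups\<close>

lemma coxeter_graph_subset: "coxeter_graph S m \<Longrightarrow> X \<subseteq> S \<Longrightarrow> coxeter_graph X m"
  unfolding coxeter_graph_def using finite_subset by blast

lemma artin_relations_gwords:
  assumes "(r, r') \<in> artin_relations S m"
  shows "r \<in> gwords S \<and> r' \<in> gwords S"
proof -
  obtain s t k where st: "r = alternating (s, True) (t, True) k" "r' = alternating (t, True) (s, True) k"
    "s \<in> S" "t \<in> S"
    using assms unfolding artin_relations_def by blast
  show ?thesis
    using set_alternating[of "(s, True)" "(t, True)" k] set_alternating[of "(t, True)" "(s, True)" k]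
      st(3,4) unfolding st(1,2) by (auto simp: in_lists_conv_set)
qed

lemma artin_relations_mono: "X \<subseteq> S \<Longrightarrow> artin_relations X m \<subseteq> artin_relations S m"
  unfolding artin_relations_def by blast

text \<open>
  Every relation omits \<open>s\<close> or \<open>t\<close>.
\<close>

lemma artin_relations_split:
  assumes "coxeter_graph S m" "s \<in> S" "t \<in> S" "s \<noteq> t" "m s t = \<infinity>"
  shows "artin_relations S m = artin_relations (S - {s}) m \<union> artin_relations (S - {t}) m"
proof
  show "artin_relations (S - {s}) m \<union> artin_relations (S - {t}) m \<subseteq> artin_relations S m"
    using artin_relations_mono[of _ S m] by auto
  have "m t s = \<infinity>" using assms unfolding coxeter_graph_def by metis
  show "artin_relations S m \<subseteq> artin_relations (S - {s}) m \<union> artin_relations (S - {t}) m"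
  proof (rule subrelI)
    fix r r' assume "(r, r') \<in> artin_relations S m"
    then obtain a b k where ab: "r = alternating (a, True) (b, True) k" "r' = alternating (b, True) (a, True) k"
      "a \<in> S" "b \<in> S" "a \<noteq> b" "m a b = enat k"
      unfolding artin_relations_def by blast
    then have "{a, b} \<subseteq> S - {s} \<or> {a, b} \<subseteq> S - {t}"
      using assms \<open>m t s = \<infinity>\<close> by auto
    then show "(r, r') \<in> artin_relations (S - {s}) m \<union> artin_relations (S - {t}) m"
      using ab unfolding artin_relations_def by blast
  qed
qed

text \<open>
  Induction on the vertex set: an edge with label \<open>\<infinity>\<close> between \<open>s\<close> and \<open>t\<close> splits the group as an amalgam of the
  groups on \<open>S - {s}\<close> and \<open>S - {t}\<close>.
\<close>

theorem torsion_free_artin_group: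
  assumes base: "\<And>S. coxeter_graph S m \<Longrightarrow> free_of_infinity S m \<Longrightarrow> torsion_free (artin_group S m)"
    and "coxeter_graph S m"
  shows "torsion_free (artin_group S m)"
proof -
  have "finite S" using assms(2) by (simp add: coxeter_graph_def)
  then show ?thesis
    using assms(2)
  proof (induction rule: finite_psubset_induct)
    case (psubset S)
    show ?case
    proof (cases "free_of_infinity S m")
      case True
      then show ?thesis using base psubset.prems by blast
    next
      case False
      then obtain s t where st: "s \<in> S" "t \<in> S" "s \<noteq> t" "m s t = \<infinity>"
        unfolding free_of_infinity_def by blast
      define X where "X i = S - {if i then s else t}" for i
      have X: "X i \<subset> S" for i using st by (auto simp: X_def)
      have cg: "coxeter_graph (X i) m" for i using coxeter_graph_subset psubset.prems X by blast
      interpret presented_amalgam X "\<lambda>i. artin_relations (X i) m" "artin_relations (X True \<inter> X False) m"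
      proof
        fix i v w
        assume vw: "v \<in> gwords (X True \<inter> X False)" "w \<in> gwords (X True \<inter> X False)"
        have sub: "X True \<inter> X False \<subseteq> X i" by (cases i) auto
        show "word_eq (X i) (artin_relations (X i) m) v w
          \<longleftrightarrow> word_eq (X True \<inter> X False) (artin_relations (X True \<inter> X False) m) v w"
          using artin_parabolic_embedding[OF cg sub vw] word_eq_mono[OF _ sub artin_relations_mono[OF sub]]
          by blast
      qed (rule artin_relations_gwords)
      have "torsion_free (presented_group (X True \<union> X False) (artin_relations (X True) m \<union> artin_relations (X False) m))"
        using psubset.IH[OF X cg] by (intro torsion_free_amalgam) (simp add: artin_group_def)
      moreover have "X True \<union> X False = S" using st by (auto simp: X_def)
      moreover have "artin_relations (X True) m \<union> artin_relations (X False) m = artin_relations S m"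
        using artin_relations_split[OF psubset.prems st] by (simp add: X_def)
      ultimately show ?thesis by (simp add: artin_group_def)
    qed
  qed
qed

lemma artin_word_eq_transport:
  assumes "word_eq S (artin_relations S m) v w" "inj_on f S"
    and m': "\<And>a b. a \<in> S \<Longrightarrow> b \<in> S \<Longrightarrow> m' (f a) (f b) = m a b"
  shows "word_eq (f ` S) (artin_relations (f ` S) m') (map (apfst f) v) (map (apfst f) w)"
  using assms(1)
proof (rule word_eq_map)
  fix r r' assume "(r, r') \<in> artin_relations S m"
  then obtain s t k where st: "r = alternating (s, True) (t, True) k" "r' = alternating (t, True) (s, True) k"
    "s \<in> S" "t \<in> S" "s \<noteq> t" "m s t = enat k"
    unfolding artin_relations_def by blast
  moreover from this have "f s \<noteq> f t" "m' (f s) (f t) = enat k"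
    using assms(2) m' by (auto dest: inj_onD)
  ultimately show "(map (apfst f) r, map (apfst f) r') \<in> artin_relations (f ` S) m'"
    unfolding artin_relations_def by (fastforce simp: map_alternating)
qed simp

lemma torsion_free_artin_group_transport:
  assumes "inj_on f S" and m': "\<And>a b. a \<in> S \<Longrightarrow> b \<in> S \<Longrightarrow> m' (f a) (f b) = m a b"
    and "torsion_free (artin_group (f ` S) m')"
  shows "torsion_free (artin_group S m)"
  unfolding artin_group_def torsion_free_presented_group_iff
proof (intro ballI allI impI)
  fix w and n :: nat
  assume w: "w \<in> gwords S" and n: "0 < n"
    and triv: "word_eq S (artin_relations S m) (concat (replicate n w)) []"
  let ?f = "map (apfst f) :: 'a gword \<Rightarrow> 'b gword"
  have "map ?f (replicate n w) = replicate n (?f w)" by simp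
  then have "word_eq (f ` S) (artin_relations (f ` S) m') (concat (replicate n (?f w))) []"
    using artin_word_eq_transport[OF triv assms(1) m'] by (simp add: map_concat)
  moreover have "?f w \<in> gwords (f ` S)" using w by (induction w) auto
  ultimately have "word_eq (f ` S) (artin_relations (f ` S) m') (?f w) []"
    using assms(3) n unfolding artin_group_def torsion_free_presented_group_iff by blast
  moreover define h where "h = the_inv_into S f"
  have hf: "h (f a) = a" if "a \<in> S" for a
    unfolding h_def using assms(1) that by (rule the_inv_into_f_f)
  then have hS: "h ` f ` S = S" by force
  moreover have "inj_on h (f ` S)" using hf by (auto intro: inj_onI)
  moreover have "m (h a) (h b) = m' a b" if "a \<in> f ` S" "b \<in> f ` S" for a b
    using that hf m' by auto
  ultimately have "word_eq (h ` f ` S) (artin_relations (h ` f ` S) m) (map (apfst h) (?f w)) (map (apfst h) [])"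
    by (intro artin_word_eq_transport[where m = m'])
  moreover have "map (apfst h) (?f w) = w"
    using w by (induction w) (auto simp: hf)
  ultimately show "word_eq S (artin_relations S m) w []" by (simp add: hS)
qed

theorem theoremA:
  assumes "\<forall>(S :: nat set) m. coxeter_graph S m \<longrightarrow> free_of_infinity S m \<longrightarrow>
             torsion_free (artin_group S m)"
  shows "\<forall>(S :: 'a set) m. coxeter_graph S m \<longrightarrow> torsion_free (artin_group S m)"
proof (intro allI impI)
  fix S :: "'a set" and m :: "'a \<Rightarrow> 'a \<Rightarrow> enat"
  assume S: "coxeter_graph S m"
  show "torsion_free (artin_group S m)"
  proof (rule torsion_free_artin_group[OF _ S])
    fix T :: "'a set"
    assume T: "coxeter_graph T m" "free_of_infinity T m"
    then have "finite T" by (simp add: coxeter_graph_def)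
    then obtain f :: "'a \<Rightarrow> nat" where f: "inj_on f T"
      using finite_imp_inj_to_nat_seg by metis
    define m' where "m' a b = m (the_inv_into T f a) (the_inv_into T f b)" for a b
    have m': "m' (f a) (f b) = m a b" if "a \<in> T" "b \<in> T" for a b
      using f that by (simp add: m'_def the_inv_into_f_f)
    have "coxeter_graph (f ` T) m'" "free_of_infinity (f ` T) m'"
      using T m' unfolding coxeter_graph_def free_of_infinity_def by auto
    then have "torsion_free (artin_group (f ` T) m')" using assms by blast
    with f m' show "torsion_free (artin_group T m)"
      by (rule torsion_free_artin_group_transport)
  qed
qed

end
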